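(* Let $k$ be a field of characteristic $0$ and $K=k[[h]]$. Let $A_0$ be a noetherian $k$-algebra and let $A_h$ be a deformation of $A_0$. Assume that $k$ has a left $A_0$-module structure such that there exists an integer $d$ with $$\mathrm{Ext}^{i}_{A_0}(k,A_0)=\{0\}\ \text{ if } i\neq d,\qquad \mathrm{Ext}^{d}_{A_0}(k,A_0)\simeq k .$$ Assume that $K$ is endowed with an $A_h$-module structure which reduces modulo $h$ to the given $A_0$-module structure on $k$. Then: (a) $\mathrm{Ext}^{i}_{A_h}(K,A_h)$ is zero if $i\neq d$. (b) $\mathrm{Ext}^{d}_{A_h}(K,A_h)$ is a free $K$-module of dimension $1$. By right multiplication (on the coefficient module $A_h$), it is a right $A_h$-module, and it is a lift of the right $A_0$-module structure (given by right multiplication) on $\mathrm{Ext}^{d}_{A_0}(k,A_0)$.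
   Context: A topologically free $K$-module is a $K$-module isomorphic to $V[[h]]$ for some $k$-vector space $V$. A topologically free $K$-algebra is a topologically free $K$-module $A_h$ with a $K$-bilinear multiplication $A_h\times A_h\to A_h$ making $A_h$ an associative (unital) algebra. A deformation of a $k$-algebra $A_0$ is a topologically free $K$-algebra $A_h$ such that $A_h/hA_h\simeq A_0$ as algebras. The $A_h$-module structure on $K$ is a left module structure compatible with the $K$-module structure of $K$; "reduces modulo $h$ to the $A_0$-module $k$" means that $K/hK=k$, as a module over $A_h/hA_h\simeq A_0$, is the given module. "Is a lift of" means that reduction modulo $h$ of the right $A_h$-module $\mathrm{Ext}^d_{A_h}(K,A_h)$ is the right $A_0$-module $\mathrm{Ext}^d_{A_0}(k,A_0)$. *)

theory Defs
  imports
    "HOL-Library.Poly_Mapping"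
    "HOL-Computational_Algebra.Formal_Power_Series"
begin

section \<open>Algebras and modules whose carrier is a type\<close>

text \<open>
  Rings are types of class \<^class>\<open>ring_1\<close>; they need not be commutative.  An algebra over a
  commutative ring and a left module over a ring are given by their scalar multiplications.
\<close>

locale algebra_over = module scale
  for scale :: "'r::comm_ring_1 \<Rightarrow> 'a::ring_1 \<Rightarrow> 'a" +
  assumes scale_mult_left: "scale c x * y = scale c (x * y)"
    and scale_mult_right: "x * scale c y = scale c (x * y)"

locale left_module =
  fixes act :: "'a::ring_1 \<Rightarrow> 'm::ab_group_add \<Rightarrow> 'm"
  assumes act_add_right: "act a (x + y) = act a x + act a y"
    and act_add_left: "act (a + b) x = act a x + act b x"
    and act_act: "act a (act b x) = act (a * b) x"
    and act_one: "act 1 x = x"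

text \<open>
  A left module over the \<open>'r\<close>-algebra \<open>'a\<close> (with scalar multiplication \<open>scale\<close>) on the
  \<open>'r\<close>-module \<open>'r\<close> itself, compatible with that \<open>'r\<close>-module structure.
\<close>

locale module_on_scalars = left_module act
  for scale :: "'r::comm_ring_1 \<Rightarrow> 'a::ring_1 \<Rightarrow> 'a" and act :: "'a \<Rightarrow> 'r \<Rightarrow> 'r" +
  assumes act_scale_left: "act (scale c a) x = c * act a x"
    and act_scale_right: "act a (c * x) = c * act a x"

definition left_ideal :: "'a::ring_1 set \<Rightarrow> bool" where
  "left_ideal I \<longleftrightarrow> 0 \<in> I \<and> (\<forall>x\<in>I. \<forall>y\<in>I. x + y \<in> I) \<and> (\<forall>a. \<forall>x\<in>I. a * x \<in> I)"

definition right_ideal :: "'a::ring_1 set \<Rightarrow> bool" where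
  "right_ideal I \<longleftrightarrow> 0 \<in> I \<and> (\<forall>x\<in>I. \<forall>y\<in>I. x + y \<in> I) \<and> (\<forall>a. \<forall>x\<in>I. x * a \<in> I)"

text \<open>Two-sided noetherian: all left ideals and all right ideals are finitely generated.\<close>

definition noetherian :: "'a::ring_1 itself \<Rightarrow> bool" where
  "noetherian _ \<longleftrightarrow>
     (\<forall>I::'a set. left_ideal I \<longrightarrow> (\<exists>S. finite S \<and> I = left_ideal hull S)) \<and>
     (\<forall>I::'a set. right_ideal I \<longrightarrow> (\<exists>S. finite S \<and> I = right_ideal hull S))"


section \<open>Modules with an explicit carrier\<close>

text \<open>
  The record is used for modules on either side: for a right module, \<open>Act M a x\<close> is \<open>x \<cdot> a\<close>.
\<close>

record ('r, 'm) gmod =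
  Carrier :: "'m set"
  Add :: "'m \<Rightarrow> 'm \<Rightarrow> 'm"
  Zero :: 'm
  Act :: "'r \<Rightarrow> 'm \<Rightarrow> 'm"

definition right_module :: "('r::ring_1, 'm) gmod \<Rightarrow> bool" where
  "right_module M \<longleftrightarrow>
     Zero M \<in> Carrier M \<and>
     (\<forall>x\<in>Carrier M. \<forall>y\<in>Carrier M. Add M x y \<in> Carrier M \<and> Add M x y = Add M y x) \<and>
     (\<forall>x\<in>Carrier M. \<forall>y\<in>Carrier M. \<forall>z\<in>Carrier M.
        Add M (Add M x y) z = Add M x (Add M y z)) \<and>
     (\<forall>x\<in>Carrier M. Add M (Zero M) x = x \<and> (\<exists>y\<in>Carrier M. Add M x y = Zero M)) \<and>
     (\<forall>a. \<forall>x\<in>Carrier M. Act M a x \<in> Carrier M) \<and>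
     (\<forall>a. \<forall>x\<in>Carrier M. \<forall>y\<in>Carrier M. Act M a (Add M x y) = Add M (Act M a x) (Act M a y)) \<and>
     (\<forall>a b. \<forall>x\<in>Carrier M. Act M (a + b) x = Add M (Act M a x) (Act M b x)) \<and>
     (\<forall>a b. \<forall>x\<in>Carrier M. Act M (a * b) x = Act M b (Act M a x)) \<and>
     (\<forall>x\<in>Carrier M. Act M 1 x = x)"

definition zero_module :: "('r, 'm) gmod \<Rightarrow> bool" where
  "zero_module M \<longleftrightarrow> Carrier M = {Zero M}"

definition module_iso :: "('r, 'm) gmod \<Rightarrow> ('r, 'n) gmod \<Rightarrow> bool"  (infix "\<cong>\<^sub>m" 50) where
  "M \<cong>\<^sub>m N \<longleftrightarrow>
     (\<exists>f. bij_betw f (Carrier M) (Carrier N) \<and>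
          (\<forall>x\<in>Carrier M. \<forall>y\<in>Carrier M. f (Add M x y) = Add N (f x) (f y)) \<and>
          (\<forall>a. \<forall>x\<in>Carrier M. f (Act M a x) = Act N a (f x)))"

definition type_module :: "('r \<Rightarrow> 'm::ab_group_add \<Rightarrow> 'm) \<Rightarrow> ('r, 'm) gmod" where
  "type_module scale = \<lparr>Carrier = UNIV, Add = (+), Zero = 0, Act = scale\<rparr>"

abbreviation regular_module :: "('r::comm_ring_1, 'r) gmod" where
  "regular_module \<equiv> type_module (*)"

definition restrict_scalars :: "('s \<Rightarrow> 'r) \<Rightarrow> ('r, 'm) gmod \<Rightarrow> ('s, 'm) gmod" where
  "restrict_scalars \<pi> M =
     \<lparr>Carrier = Carrier M, Add = Add M, Zero = Zero M, Act = (\<lambda>s. Act M (\<pi> s))\<rparr>"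

definition free_of_rank_1 :: "('r::comm_ring_1, 'm) gmod \<Rightarrow> bool" where
  "free_of_rank_1 M \<longleftrightarrow> right_module M \<and> M \<cong>\<^sub>m (regular_module :: ('r, 'r) gmod)"

definition coset :: "('r, 'm) gmod \<Rightarrow> 'm set \<Rightarrow> 'm \<Rightarrow> 'm set" where
  "coset M N x = Add M x ` N"

text \<open>
  The quotient of \<open>M\<close> by a submodule with carrier \<open>N\<close>.  The action of \<open>r\<close> on a coset is the
  union of the cosets of the \<open>r\<close>-multiples of its elements, and these are all the same coset.
\<close>

definition quotient_module :: "('r, 'm) gmod \<Rightarrow> 'm set \<Rightarrow> ('r, 'm set) gmod" where
  "quotient_module M N =
     \<lparr>Carrier = coset M N ` Carrier M,
      Add = (\<lambda>X Y. {Add M x y |x y. x \<in> X \<and> y \<in> Y}),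
      Zero = N,
      Act = (\<lambda>r X. \<Union>x\<in>X. coset M N (Act M r x))\<rparr>"

text \<open>\<open>M/rM\<close>; used only for \<open>r\<close> whose action commutes with that of every scalar.\<close>

definition reduction :: "('r, 'm) gmod \<Rightarrow> 'r \<Rightarrow> ('r, 'm set) gmod" where
  "reduction M r = quotient_module M (Act M r ` Carrier M)"


section \<open>The standard free resolution of a left module\<close>

text \<open>
  For a left \<open>'a\<close>-module \<open>'m\<close> the resolution starts with the free module on the elements
  of \<open>'m\<close>, and in each further degree has one free generator for every formal linear
  combination of the previous generators that lies in the kernel of the previous map.
  The free module on a set \<open>G\<close> of generators consists of the finitely supported functions
  that vanish outside \<open>G\<close>.
\<close>

datatype ('a, 'm) gen = Base 'm | Syz "('a \<times> ('a, 'm) gen) list"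

type_synonym ('a, 'm) chain = "('a, 'm) gen \<Rightarrow>\<^sub>0 'a"

definition scale_chain :: "'a::ring_1 \<Rightarrow> ('g \<Rightarrow>\<^sub>0 'a) \<Rightarrow> ('g \<Rightarrow>\<^sub>0 'a)" where
  "scale_chain a p = Poly_Mapping.map ((*) a) p"

definition lin_ext ::
  "('a::ring_1 \<Rightarrow> 'm::ab_group_add \<Rightarrow> 'm) \<Rightarrow> ('g \<Rightarrow> 'm) \<Rightarrow> ('g \<Rightarrow>\<^sub>0 'a) \<Rightarrow> 'm" where
  "lin_ext act f p = (\<Sum>g\<in>Poly_Mapping.keys p. act (Poly_Mapping.lookup p g) (f g))"

definition lincomb :: "('a::ring_1 \<times> 'g) list \<Rightarrow> ('g \<Rightarrow>\<^sub>0 'a)" where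
  "lincomb l = (\<Sum>(a, g)\<leftarrow>l. Poly_Mapping.single g a)"

definition augmentation ::
  "('a::ring_1 \<Rightarrow> 'm::ab_group_add \<Rightarrow> 'm) \<Rightarrow> ('a, 'm) chain \<Rightarrow> 'm" where
  "augmentation act = lin_ext act (\<lambda>g. case g of Base m \<Rightarrow> m | Syz l \<Rightarrow> 0)"

definition boundary :: "('a::ring_1, 'm) chain \<Rightarrow> ('a, 'm) chain" where
  "boundary = lin_ext scale_chain (\<lambda>g. case g of Base m \<Rightarrow> 0 | Syz l \<Rightarrow> lincomb l)"

primrec gens :: "('a::ring_1 \<Rightarrow> 'm::ab_group_add \<Rightarrow> 'm) \<Rightarrow> nat \<Rightarrow> ('a, 'm) gen set" where
  "gens act 0 = range Base"
| "gens act (Suc n) =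
     {Syz l |l. snd ` set l \<subseteq> gens act n \<and>
        (if n = 0 then augmentation act (lincomb l) = 0 else boundary (lincomb l) = 0)}"

definition resolution :: "('a::ring_1 \<Rightarrow> 'm::ab_group_add \<Rightarrow> 'm) \<Rightarrow> nat \<Rightarrow> ('a, 'm) chain set" where
  "resolution act n = {p. Poly_Mapping.keys p \<subseteq> gens act n}"

text \<open>
  The complex
  \<open>\<dots> \<rightarrow> resolution act 2 \<rightarrow> resolution act 1 \<rightarrow> resolution act 0 \<rightarrow> 'm \<rightarrow> 0\<close> is exact.
\<close>

lemma lookup_scale_chain [simp]:
  "Poly_Mapping.lookup (scale_chain a p) g = a * Poly_Mapping.lookup p g"
  unfolding scale_chain_def by (simp add: Poly_Mapping.map.rep_eq when_def)

lemma left_module_scale_chain: "left_module scale_chain"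
  by unfold_locales (auto intro!: poly_mapping_eqI simp: lookup_add algebra_simps)

context left_module
begin

lemma act_zero_left [simp]: "act 0 x = 0"
  using act_add_left[of 0 0 x] by simp

lemma act_zero_right [simp]: "act a 0 = 0"
  using act_add_right[of a 0 0] by simp

lemma lin_ext_superset:
  assumes "finite S" "Poly_Mapping.keys p \<subseteq> S"
  shows "lin_ext act f p = (\<Sum>g\<in>S. act (Poly_Mapping.lookup p g) (f g))"
  unfolding lin_ext_def using assms
  by (intro sum.mono_neutral_left) (auto simp: in_keys_iff)

lemma lin_ext_0 [simp]: "lin_ext act f 0 = 0"
  by (simp add: lin_ext_def)

lemma lin_ext_single [simp]: "lin_ext act f (Poly_Mapping.single g a) = act a (f g)"
  by (simp add: lin_ext_def)

lemma lin_ext_add: "lin_ext act f (p + q) = lin_ext act f p + lin_ext act f q"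
proof -
  let ?S = "Poly_Mapping.keys p \<union> Poly_Mapping.keys q"
  have "finite ?S" by simp
  moreover have "Poly_Mapping.keys (p + q) \<subseteq> ?S" by (rule keys_add)
  ultimately show ?thesis
    using lin_ext_superset[of ?S p f] lin_ext_superset[of ?S q f] lin_ext_superset[of ?S "p + q" f]
    by (simp add: lookup_add act_add_left sum.distrib)
qed

lemma act_sum: "act a (sum f S) = (\<Sum>x\<in>S. act a (f x))"
  by (induction S rule: infinite_finite_induct) (auto simp: act_add_right)

lemma lin_ext_scale: "lin_ext act f (scale_chain a p) = act a (lin_ext act f p)"
proof -
  have "Poly_Mapping.keys (scale_chain a p) \<subseteq> Poly_Mapping.keys p"
    by (auto simp: in_keys_iff)
  then have "lin_ext act f (scale_chain a p)
      = (\<Sum>g\<in>Poly_Mapping.keys p. act (a * Poly_Mapping.lookup p g) (f g))"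
    by (subst lin_ext_superset[of "Poly_Mapping.keys p"]) auto
  then show ?thesis by (simp add: lin_ext_def act_sum act_act)
qed

lemma lin_ext_sum: "lin_ext act f (sum h S) = (\<Sum>x\<in>S. lin_ext act f (h x))"
  by (induction S rule: infinite_finite_induct) (auto simp: lin_ext_add)

end

lemma lincomb_surj:
  fixes p :: "'g \<Rightarrow>\<^sub>0 'a::ring_1"
  obtains l where "lincomb l = p" "snd ` set l \<subseteq> Poly_Mapping.keys p"
proof -
  obtain gs where gs: "set gs = Poly_Mapping.keys p" "distinct gs"
    using finite_distinct_list[of "Poly_Mapping.keys p"] finite_keys[of p] by metis
  let ?l = "map (\<lambda>g. (Poly_Mapping.lookup p g, g)) gs"
  have "lincomb ?l = (\<Sum>g\<in>Poly_Mapping.keys p. Poly_Mapping.single g (Poly_Mapping.lookup p g))"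
    by (simp add: lincomb_def comp_def sum_list_distinct_conv_sum_set[OF gs(2)] gs(1))
  also have "\<dots> = p"
  proof (rule poly_mapping_eqI)
    fix k
    have "Poly_Mapping.lookup p k = 0" if "k \<notin> Poly_Mapping.keys p"
      using that by (simp add: in_keys_iff)
    then show "Poly_Mapping.lookup (\<Sum>g\<in>Poly_Mapping.keys p.
        Poly_Mapping.single g (Poly_Mapping.lookup p g)) k = Poly_Mapping.lookup p k"
      by (cases "k \<in> Poly_Mapping.keys p") (simp_all add: lookup_sum lookup_single when_def)
  qed
  finally have eq: "lincomb ?l = p" .
  have "snd ` set ?l = Poly_Mapping.keys p"
    by (simp add: image_image gs(1))
  then show thesis
    by (intro that[OF eq] equalityD1)
qed

lemma augmentation_surj:
  assumes "left_module act"
  shows "augmentation act ` resolution act 0 = UNIV"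
proof -
  interpret left_module act by fact
  have "m = augmentation act (Poly_Mapping.single (Base m) 1)" for m
    by (simp add: augmentation_def act_one)
  moreover have "Poly_Mapping.single (Base m) 1 \<in> resolution act 0" for m
    by (auto simp: resolution_def)
  ultimately show ?thesis by blast
qed

lemma lincomb_in_resolution: "snd ` set l \<subseteq> gens act n \<Longrightarrow> lincomb l \<in> resolution act n"
proof (induction l)
  case (Cons x l)
  have "Poly_Mapping.keys (lincomb (x # l)) \<subseteq> {snd x} \<union> Poly_Mapping.keys (lincomb l)"
    using keys_add[of "Poly_Mapping.single (snd x) (fst x)" "lincomb l"]
    by (auto simp: lincomb_def case_prod_beta split: if_splits)
  then show ?case using Cons by (auto simp: resolution_def)
qed (simp add: lincomb_def resolution_def)

lemma boundary_in_kernel: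
  assumes "left_module act" "p \<in> resolution act (Suc n)"
  shows "boundary p \<in> resolution act n"
    and "if n = 0 then augmentation act (boundary p) = 0 else boundary (boundary p) = 0"
proof -
  interpret left_module act by fact
  interpret C: left_module "scale_chain :: 'a \<Rightarrow> ('a, 'b) chain \<Rightarrow> ('a, 'b) chain"
    by (rule left_module_scale_chain)
  define s :: "('a, 'b) gen \<Rightarrow> ('a, 'b) chain"
    where "s = (\<lambda>g. case g of Base m \<Rightarrow> 0 | Syz l \<Rightarrow> lincomb l)"
  have bd: "boundary p
      = (\<Sum>g\<in>Poly_Mapping.keys p. scale_chain (Poly_Mapping.lookup p g) (s g))"
    by (simp add: boundary_def lin_ext_def s_def)
  have s: "s g \<in> resolution act n \<and>
      (if n = 0 then augmentation act (s g) = 0 else boundary (s g) = 0)"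
    if "g \<in> Poly_Mapping.keys p" for g
  proof -
    have "g \<in> gens act (Suc n)"
      using that assms(2) unfolding resolution_def by blast
    then obtain l where l: "g = Syz l" "snd ` set l \<subseteq> gens act n"
        "if n = 0 then augmentation act (lincomb l) = 0 else boundary (lincomb l) = 0"
      unfolding gens.simps by blast
    then show ?thesis
      using lincomb_in_resolution[OF l(2)] by (simp add: s_def)
  qed
  have "Poly_Mapping.lookup (boundary p) g = 0" if "g \<notin> gens act n" for g
  proof -
    have "Poly_Mapping.lookup (s g') g = 0" if "g' \<in> Poly_Mapping.keys p" for g'
      using s[OF that] \<open>g \<notin> gens act n\<close> by (auto simp: resolution_def in_keys_iff)
    then show ?thesis unfolding bd by (simp add: lookup_sum)
  qed
  then show "boundary p \<in> resolution act n"
    by (auto simp: resolution_def in_keys_iff)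
  show "if n = 0 then augmentation act (boundary p) = 0 else boundary (boundary p) = 0"
  proof (cases "n = 0")
    case True
    have "augmentation act (boundary p)
        = (\<Sum>g\<in>Poly_Mapping.keys p. act (Poly_Mapping.lookup p g) (augmentation act (s g)))"
      unfolding bd by (simp add: augmentation_def lin_ext_sum lin_ext_scale)
    also have "\<dots> = 0"
      using s True by (intro sum.neutral) simp
    finally show ?thesis using True by simp
  next
    case False
    have "boundary (boundary p)
        = (\<Sum>g\<in>Poly_Mapping.keys p. scale_chain (Poly_Mapping.lookup p g) (boundary (s g)))"
      unfolding bd by (simp add: boundary_def C.lin_ext_sum C.lin_ext_scale)
    also have "\<dots> = 0"
      using s False by (intro sum.neutral) simp
    finally show ?thesis using False by simp
  qed
qed

lemma standard_resolution_exact: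
  assumes "left_module act"
  shows "boundary ` resolution act (Suc 0) = {p \<in> resolution act 0. augmentation act p = 0}"
    and "boundary ` resolution act (Suc (Suc n)) = {p \<in> resolution act (Suc n). boundary p = 0}"
proof -
  interpret C: left_module "scale_chain :: 'a \<Rightarrow> ('a, 'b) chain \<Rightarrow> ('a, 'b) chain"
    by (rule left_module_scale_chain)
  have lift: "p \<in> boundary ` resolution act (Suc n)"
    if "p \<in> resolution act n"
      "if n = 0 then augmentation act p = 0 else boundary p = 0" for p n
  proof -
    obtain l where l: "lincomb l = p" "snd ` set l \<subseteq> Poly_Mapping.keys p"
      by (rule lincomb_surj)
    have "snd ` set l \<subseteq> gens act n"
      using l(2) that(1) by (simp add: resolution_def)
    then have "Syz l \<in> gens act (Suc n)"
      using l(1) that(2) by simp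
    then have "Poly_Mapping.single (Syz l) 1 \<in> resolution act (Suc n)"
      by (simp add: resolution_def)
    moreover have "boundary (Poly_Mapping.single (Syz l) 1) = p"
      using l by (simp add: boundary_def C.act_one)
    ultimately show ?thesis by (metis image_eqI)
  qed
  show "boundary ` resolution act (Suc 0) = {p \<in> resolution act 0. augmentation act p = 0}"
  proof (intro equalityI subsetI)
    fix q assume "q \<in> boundary ` resolution act (Suc 0)"
    then obtain p where p: "p \<in> resolution act (Suc 0)" "q = boundary p"
      by blast
    then show "q \<in> {p \<in> resolution act 0. augmentation act p = 0}"
      using boundary_in_kernel[OF assms p(1)] by simp
  next
    fix q assume "q \<in> {p \<in> resolution act 0. augmentation act p = 0}"
    then show "q \<in> boundary ` resolution act (Suc 0)"
      by (intro lift) simp_all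
  qed
  show "boundary ` resolution act (Suc (Suc n)) = {p \<in> resolution act (Suc n). boundary p = 0}"
  proof (intro equalityI subsetI)
    fix q assume "q \<in> boundary ` resolution act (Suc (Suc n))"
    then obtain p where p: "p \<in> resolution act (Suc (Suc n))" "q = boundary p"
      by blast
    then show "q \<in> {p \<in> resolution act (Suc n). boundary p = 0}"
      using boundary_in_kernel[OF assms p(1)] by simp
  next
    fix q assume "q \<in> {p \<in> resolution act (Suc n). boundary p = 0}"
    then show "q \<in> boundary ` resolution act (Suc (Suc n))"
      by (intro lift) simp_all
  qed
qed


section \<open>Ext with coefficients in the ring\<close>

text \<open>
  An \<open>n\<close>-cochain is an \<open>'a\<close>-linear map from \<open>resolution act n\<close> to \<open>'a\<close>, made total by the value
  \<open>0\<close> elsewhere.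
\<close>

definition cochains ::
  "('a::ring_1 \<Rightarrow> 'm::ab_group_add \<Rightarrow> 'm) \<Rightarrow> nat \<Rightarrow> (('a, 'm) chain \<Rightarrow> 'a) set" where
  "cochains act n =
     {f. (\<forall>p\<in>resolution act n. \<forall>q\<in>resolution act n. f (p + q) = f p + f q) \<and>
         (\<forall>a. \<forall>p\<in>resolution act n. f (scale_chain a p) = a * f p) \<and>
         (\<forall>p. p \<notin> resolution act n \<longrightarrow> f p = 0)}"

definition coboundary ::
  "('a::ring_1 \<Rightarrow> 'm::ab_group_add \<Rightarrow> 'm) \<Rightarrow> nat \<Rightarrow>
     (('a, 'm) chain \<Rightarrow> 'a) \<Rightarrow> (('a, 'm) chain \<Rightarrow> 'a)" where
  "coboundary act n f = (\<lambda>p. if p \<in> resolution act (Suc n) then f (boundary p) else 0)"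

definition cocycles ::
  "('a::ring_1 \<Rightarrow> 'm::ab_group_add \<Rightarrow> 'm) \<Rightarrow> nat \<Rightarrow> (('a, 'm) chain \<Rightarrow> 'a) set" where
  "cocycles act n = {f \<in> cochains act n. coboundary act n f = (\<lambda>_. 0)}"

definition coboundaries ::
  "('a::ring_1 \<Rightarrow> 'm::ab_group_add \<Rightarrow> 'm) \<Rightarrow> nat \<Rightarrow> (('a, 'm) chain \<Rightarrow> 'a) set" where
  "coboundaries act n =
     (case n of 0 \<Rightarrow> {\<lambda>_. 0} | Suc m \<Rightarrow> coboundary act m ` cochains act m)"

text \<open>
  \<open>Ext\<^sup>n(M, A)\<close> for a left \<open>A\<close>-module \<open>M\<close>, with its right \<open>A\<close>-module structure given by right
  multiplication on the values of cochains.
\<close>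

definition Ext ::
  "nat \<Rightarrow> ('a::ring_1 \<Rightarrow> 'm::ab_group_add \<Rightarrow> 'm) \<Rightarrow> ('a, (('a, 'm) chain \<Rightarrow> 'a) set) gmod" where
  "Ext n act =
     quotient_module
       \<lparr>Carrier = cocycles act n,
        Add = (\<lambda>f g p. f p + g p),
        Zero = (\<lambda>_. 0),
        Act = (\<lambda>a f p. f p * a)\<rparr>
       (coboundaries act n)"

text \<open>
  Over an \<open>'r\<close>-algebra a right module is also an \<open>'r\<close>-module, through \<open>c \<mapsto> c \<cdot> 1\<close>.
\<close>

abbreviation scalar_module ::
  "('r::comm_ring_1 \<Rightarrow> 'a::ring_1 \<Rightarrow> 'a) \<Rightarrow> ('a, 'm) gmod \<Rightarrow> ('r, 'm) gmod" where
  "scalar_module scale M \<equiv> restrict_scalars (\<lambda>c. scale c 1) M"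


section \<open>Deformations\<close>

text \<open>The \<open>k[[h]]\<close>-module \<open>V[[h]]\<close> for a \<open>k\<close>-vector space \<open>V\<close>.\<close>

definition fps_scale ::
  "('k::field \<Rightarrow> 'v::ab_group_add \<Rightarrow> 'v) \<Rightarrow> 'k fps \<Rightarrow> 'v fps \<Rightarrow> 'v fps" where
  "fps_scale scale c v =
     Abs_fps (\<lambda>n. \<Sum>i=0..n. scale (fps_nth c i) (fps_nth v (n - i)))"

definition topologically_free ::
  "('k::field fps \<Rightarrow> 'b::ab_group_add \<Rightarrow> 'b) \<Rightarrow> ('k \<Rightarrow> 'v::ab_group_add \<Rightarrow> 'v) \<Rightarrow> bool" where
  "topologically_free scaleh scaleV \<longleftrightarrow>
     module scaleh \<and> vector_space scaleV \<and>
     type_module scaleh \<cong>\<^sub>m type_module (fps_scale scaleV)"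

definition class_mod_h :: "('k::field fps \<Rightarrow> 'b::ab_group_add \<Rightarrow> 'b) \<Rightarrow> 'b \<Rightarrow> 'b set" where
  "class_mod_h scaleh x = coset (type_module scaleh) (range (scaleh fps_X)) x"

text \<open>
  \<open>\<phi>\<close> is an isomorphism of \<open>k\<close>-algebras from \<open>A\<^sub>h/hA\<^sub>h\<close> to \<open>A\<^sub>0\<close>.  The algebra operations of
  the quotient are those induced on classes by the operations on representatives.
\<close>

definition quotient_algebra_iso ::
  "('k::field fps \<Rightarrow> 'b::ring_1 \<Rightarrow> 'b) \<Rightarrow> ('k \<Rightarrow> 'a::ring_1 \<Rightarrow> 'a) \<Rightarrow> ('b set \<Rightarrow> 'a) \<Rightarrow> bool" where
  "quotient_algebra_iso scaleh scale0 \<phi> \<longleftrightarrow>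
     bij_betw \<phi> (Carrier (reduction (type_module scaleh) fps_X)) UNIV \<and>
     (\<forall>x y. \<phi> (class_mod_h scaleh (x + y)) = \<phi> (class_mod_h scaleh x) + \<phi> (class_mod_h scaleh y)) \<and>
     (\<forall>x y. \<phi> (class_mod_h scaleh (x * y)) = \<phi> (class_mod_h scaleh x) * \<phi> (class_mod_h scaleh y)) \<and>
     \<phi> (class_mod_h scaleh 1) = 1 \<and>
     (\<forall>c x. \<phi> (class_mod_h scaleh (scaleh (fps_const c) x)) = scale0 c (\<phi> (class_mod_h scaleh x)))"

text \<open>
  The \<open>k[[h]]\<close>-algebra \<open>A\<^sub>h\<close>, which is isomorphic to \<open>V[[h]]\<close> as a module, is a deformation of
  the \<open>k\<close>-algebra \<open>A\<^sub>0\<close> through the isomorphism \<open>\<phi>\<close>.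
\<close>

definition deformation ::
  "('k::field \<Rightarrow> 'v::ab_group_add \<Rightarrow> 'v) \<Rightarrow> ('k fps \<Rightarrow> 'b::ring_1 \<Rightarrow> 'b) \<Rightarrow>
     ('k \<Rightarrow> 'a::ring_1 \<Rightarrow> 'a) \<Rightarrow> ('b set \<Rightarrow> 'a) \<Rightarrow> bool" where
  "deformation scaleV scaleh scale0 \<phi> \<longleftrightarrow>
     algebra_over scaleh \<and> topologically_free scaleh scaleV \<and>
     quotient_algebra_iso scaleh scale0 \<phi>"

text \<open>
  The action \<open>acth\<close> on \<open>K = k[[h]]\<close> reduces to \<open>act0\<close> on \<open>k\<close>, where \<open>K/hK\<close> is identified with
  \<open>k\<close> by the constant coefficient.
\<close>

definition reduces_to ::
  "('k::field fps \<Rightarrow> 'b::ring_1 \<Rightarrow> 'b) \<Rightarrow> ('b set \<Rightarrow> 'a::ring_1) \<Rightarrow>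
     ('b \<Rightarrow> 'k fps \<Rightarrow> 'k fps) \<Rightarrow> ('a \<Rightarrow> 'k \<Rightarrow> 'k) \<Rightarrow> bool" where
  "reduces_to scaleh \<phi> acth act0 \<longleftrightarrow>
     (\<forall>b x. fps_nth (acth b x) 0 = act0 (\<phi> (class_mod_h scaleh b)) (fps_nth x 0))"

text \<open>
  The right \<open>A\<^sub>h\<close>-module \<open>M\<close> is a lift of the right \<open>A\<^sub>0\<close>-module \<open>N\<close>: \<open>M/hM\<close> is isomorphic to
  \<open>N\<close>, on which \<open>A\<^sub>h\<close> acts through \<open>A\<^sub>h \<rightarrow> A\<^sub>h/hA\<^sub>h \<cong> A\<^sub>0\<close>.
\<close>

definition is_lift ::
  "('k::field fps \<Rightarrow> 'b::ring_1 \<Rightarrow> 'b) \<Rightarrow> ('b set \<Rightarrow> 'a::ring_1) \<Rightarrow>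
     ('b, 'm) gmod \<Rightarrow> ('a, 'n) gmod \<Rightarrow> bool" where
  "is_lift scaleh \<phi> M N \<longleftrightarrow>
     reduction M (scaleh fps_X 1) \<cong>\<^sub>m restrict_scalars (\<lambda>b. \<phi> (class_mod_h scaleh b)) N"

end

theory Submission
  imports Defs
begin

text \<open>
  Cochains on a free resolution of \<open>K\<close> over \<open>A\<^sub>h\<close> form a complex of products of copies of \<open>A\<^sub>h\<close>,
  which are \<open>h\<close>-torsion free and \<open>h\<close>-adically complete and separated.  As \<open>K\<close> is \<open>h\<close>-torsion free,
  the resolution reduces modulo \<open>h\<close> to a free resolution of \<open>k\<close> over \<open>A\<^sub>0\<close>, so the complex modulo
  \<open>h\<close> computes \<open>Ext\<^bsub>A\<^sub>0\<^esub>(k, A\<^sub>0)\<close> by the comparison theorem.  Successive approximation shows that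
  vanishing in a degree lifts from the reduced complex, and that a class generating \<open>Ext\<^sup>d\<close> modulo
  \<open>h\<close> lifts to a generator.  Vanishing in degree \<open>d + 1\<close> lifts cocycles, and vanishing in degree
  \<open>d - 1\<close> makes \<open>Ext\<^sup>d\<close> torsion free.
\<close>

section \<open>Free resolutions on generators\<close>

text \<open>The reduction of the standard resolution of K is not the standard resolution of k: its
  generators are still indexed by elements of K and by formal combinations over A_h. Resolutions are
  therefore treated abstractly, as generating sets with a boundary and an augmentation. Cochains
  become arbitrary functions on generators, so that division by h, torsion freeness and infinite
  sums are settled one generator at a time. The approximation takes place on cochains rather than on
  classes, because nothing is known beforehand about h-adic separatedness of Ext: a class divisible
  by every power of h might be nonzero. The correcting primitives are summed along with the scalars,
  so the limit is an identity of cochains with an explicit primitive. In degree d this gives a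
  surjection from K onto Ext. It is injective because a nonzero power series is a unit times a power
  of h and h cancels in Ext.\<close>

context left_module
begin

lemma act_minus_right: "act a (- x) = - act a x"
  using act_add_right[of a x "- x"] by (simp add: eq_neg_iff_add_eq_0 add.commute)

lemma act_diff_right: "act a (x - y) = act a x - act a y"
  using act_add_right[of a x "- y"] by (simp add: act_minus_right)

lemma lin_ext_cong:
  "(\<And>g. g \<in> Poly_Mapping.keys p \<Longrightarrow> f g = f' g) \<Longrightarrow> lin_ext act f p = lin_ext act f' p"
  by (simp add: lin_ext_def)

lemma lin_ext_zero_fun [simp]: "lin_ext act (\<lambda>_. 0) p = 0"
  by (simp add: lin_ext_def)

lemma lin_ext_add_fun: "lin_ext act (\<lambda>g. f g + f' g) p = lin_ext act f p + lin_ext act f' p"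
  by (simp add: lin_ext_def act_add_right sum.distrib)

lemma lin_ext_diff_fun: "lin_ext act (\<lambda>g. f g - f' g) p = lin_ext act f p - lin_ext act f' p"
  by (simp add: lin_ext_def act_diff_right sum_subtractf)

lemma lin_ext_minus: "lin_ext act f (- p) = - lin_ext act f p"
  using lin_ext_add[of f p "- p"] by (simp add: eq_neg_iff_add_eq_0 add.commute)

lemma lin_ext_diff: "lin_ext act f (p - q) = lin_ext act f p - lin_ext act f q"
  using lin_ext_add[of f p "- q"] by (simp add: lin_ext_minus)

end

text \<open>A linear map from a free left module to the ring is recorded by its values
  \<open>f\<close> on generators; \<open>pairing f p\<close> is its value at \<open>p\<close>.
  Coefficients stand on the left, so right multiplication of the values commutes with it.\<close>

abbreviation pairing :: "('g \<Rightarrow> 'a::ring_1) \<Rightarrow> ('g \<Rightarrow>\<^sub>0 'a) \<Rightarrow> 'a" where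
  "pairing \<equiv> lin_ext (*)"

abbreviation chain_ext :: "('g \<Rightarrow> ('g' \<Rightarrow>\<^sub>0 'a::ring_1)) \<Rightarrow> ('g \<Rightarrow>\<^sub>0 'a) \<Rightarrow> ('g' \<Rightarrow>\<^sub>0 'a)" where
  "chain_ext \<equiv> lin_ext scale_chain"

interpretation pair: left_module "(*) :: 'a::ring_1 \<Rightarrow> 'a \<Rightarrow> 'a"
  by unfold_locales (auto simp: algebra_simps)

interpretation chain: left_module "scale_chain :: 'a::ring_1 \<Rightarrow> ('g \<Rightarrow>\<^sub>0 'a) \<Rightarrow> ('g \<Rightarrow>\<^sub>0 'a)"
  by (rule left_module_scale_chain)

lemma pairing_mult_right: "pairing (\<lambda>g. f g * a) p = pairing f p * a"
  by (simp add: lin_ext_def sum_distrib_right mult.assoc)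

text \<open>The composition law of linear extensions. It serves for compositions of boundaries,
  chain maps, homotopies and pullbacks of cochains alike.\<close>

lemma (in left_module) lin_ext_chain_ext:
  "lin_ext act f (chain_ext \<phi> p) = lin_ext act (\<lambda>g. lin_ext act f (\<phi> g)) p"
  by (simp add: lin_ext_def[of scale_chain] lin_ext_sum lin_ext_scale)
    (simp add: lin_ext_def[of act "\<lambda>g. lin_ext act f (\<phi> g)"])

lemma keys_chain_ext:
  assumes "\<And>g. g \<in> Poly_Mapping.keys p \<Longrightarrow> Poly_Mapping.keys (\<phi> g) \<subseteq> S"
  shows "Poly_Mapping.keys (chain_ext \<phi> p) \<subseteq> S"
proof
  fix x assume "x \<in> Poly_Mapping.keys (chain_ext \<phi> p)"
  then have "(\<Sum>g\<in>Poly_Mapping.keys p. Poly_Mapping.lookup p g * Poly_Mapping.lookup (\<phi> g) x) \<noteq> 0"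
    by (simp add: lin_ext_def in_keys_iff lookup_sum)
  then obtain g where "g \<in> Poly_Mapping.keys p" "Poly_Mapping.lookup (\<phi> g) x \<noteq> 0"
    by (metis (no_types, lifting) mult_zero_right sum.neutral)
  then have "x \<in> Poly_Mapping.keys (\<phi> g)"
    by (simp add: in_keys_iff)
  then show "x \<in> S"
    using assms \<open>g \<in> Poly_Mapping.keys p\<close> by blast
qed

lemma chain_ext_single: "chain_ext (\<lambda>g. Poly_Mapping.single g 1) p = p"
proof (rule poly_mapping_eqI)
  fix k
  have "Poly_Mapping.lookup (chain_ext (\<lambda>g. Poly_Mapping.single g 1) p) k =
      (\<Sum>g\<in>Poly_Mapping.keys p. if g = k then Poly_Mapping.lookup p g else 0)"
    by (simp add: lin_ext_def lookup_sum lookup_single when_def if_distrib cong: if_cong)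
  then show "Poly_Mapping.lookup (chain_ext (\<lambda>g. Poly_Mapping.single g 1) p) k = Poly_Mapping.lookup p k"
    by (simp add: in_keys_iff)
qed

lemma keys_minus_subset:
  fixes p q :: "'g \<Rightarrow>\<^sub>0 'a::ring_1"
  assumes "Poly_Mapping.keys p \<subseteq> S" "Poly_Mapping.keys q \<subseteq> S"
  shows "Poly_Mapping.keys (p - q) \<subseteq> S"
  using assms keys_diff[of p q] by blast

lemma keys_scale_chain: "Poly_Mapping.keys (scale_chain a p) \<subseteq> Poly_Mapping.keys p"
  by (auto simp: in_keys_iff)

text \<open>In degree 0 the augmentation takes the place of the boundary. With this convention one
  exactness axiom covers all degrees and inductions over the degree start uniformly.\<close>

definition is_cycle ::
  "('a::ring_1 \<Rightarrow> 'm::ab_group_add \<Rightarrow> 'm) \<Rightarrow> (nat \<Rightarrow> 'g set) \<Rightarrow> ('g \<Rightarrow> ('g \<Rightarrow>\<^sub>0 'a)) \<Rightarrow> ('g \<Rightarrow> 'm) \<Rightarrow>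
     nat \<Rightarrow> ('g \<Rightarrow>\<^sub>0 'a) \<Rightarrow> bool" where
  "is_cycle act G D e n p \<longleftrightarrow>
     Poly_Mapping.keys p \<subseteq> G n \<and> (if n = 0 then lin_ext act e p = 0 else chain_ext D p = 0)"

text \<open>
  The free modules on the sets \<open>G n\<close> need not have disjoint generators, so one function \<open>D\<close>
  serves as the boundary in all degrees.
\<close>

locale free_resolution = left_module act
  for act :: "'a::ring_1 \<Rightarrow> 'm::ab_group_add \<Rightarrow> 'm" +
  fixes G :: "nat \<Rightarrow> 'g set" and D :: "'g \<Rightarrow> ('g \<Rightarrow>\<^sub>0 'a)" and e :: "'g \<Rightarrow> 'm"
  assumes augmentation_onto: "\<exists>p. Poly_Mapping.keys p \<subseteq> G 0 \<and> lin_ext act e p = m"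
    and D_cycle: "g \<in> G (Suc n) \<Longrightarrow> is_cycle act G D e n (D g)"
    and exact: "is_cycle act G D e n p \<Longrightarrow>
      \<exists>q. Poly_Mapping.keys q \<subseteq> G (Suc n) \<and> chain_ext D q = p"
begin

lemma keys_D: "g \<in> G (Suc n) \<Longrightarrow> Poly_Mapping.keys (D g) \<subseteq> G n"
  using D_cycle by (simp add: is_cycle_def)

lemma D_D: "g \<in> G (Suc (Suc n)) \<Longrightarrow> chain_ext D (D g) = 0"
  using D_cycle[of g "Suc n"] by (simp add: is_cycle_def)

lemma boundary_is_cycle:
  assumes "Poly_Mapping.keys q \<subseteq> G (Suc n)"
  shows "is_cycle act G D e n (chain_ext D q)"
proof -
  have *: "is_cycle act G D e n (D g)" if "g \<in> Poly_Mapping.keys q" for g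
    using that assms D_cycle by blast
  have "Poly_Mapping.keys (chain_ext D q) \<subseteq> G n"
    using * by (intro keys_chain_ext) (auto simp: is_cycle_def)
  moreover have "lin_ext act e (chain_ext D q) = 0" if "n = 0"
    using * that
    by (subst lin_ext_chain_ext, subst lin_ext_cong[where f' = "\<lambda>_. 0"]) (auto simp: is_cycle_def)
  moreover have "chain_ext D (chain_ext D q) = 0" if "n \<noteq> 0"
    using * that
    by (subst chain.lin_ext_chain_ext, subst chain.lin_ext_cong[where f' = "\<lambda>_. 0"])
      (auto simp: is_cycle_def)
  ultimately show ?thesis
    by (simp add: is_cycle_def)
qed

end


section \<open>The comparison theorem\<close>

text \<open>Compatibility with \<open>e\<close> and \<open>e'\<close> means that the map lifts the
  identity of the resolved module. There is one function per degree because a generator may occur in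
  several degrees.\<close>

definition chain_map ::
  "('a::ring_1 \<Rightarrow> 'm::ab_group_add \<Rightarrow> 'm) \<Rightarrow>
     (nat \<Rightarrow> 'g set) \<Rightarrow> ('g \<Rightarrow> ('g \<Rightarrow>\<^sub>0 'a)) \<Rightarrow> ('g \<Rightarrow> 'm) \<Rightarrow>
     (nat \<Rightarrow> 'g' set) \<Rightarrow> ('g' \<Rightarrow> ('g' \<Rightarrow>\<^sub>0 'a)) \<Rightarrow> ('g' \<Rightarrow> 'm) \<Rightarrow>
     (nat \<Rightarrow> 'g \<Rightarrow> ('g' \<Rightarrow>\<^sub>0 'a)) \<Rightarrow> bool" where
  "chain_map act G D e G' D' e' \<phi> \<longleftrightarrow>
     (\<forall>n. \<forall>g\<in>G n. Poly_Mapping.keys (\<phi> n g) \<subseteq> G' n) \<and>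
     (\<forall>g\<in>G 0. lin_ext act e' (\<phi> 0 g) = e g) \<and>
     (\<forall>n. \<forall>g\<in>G (Suc n). chain_ext D' (\<phi> (Suc n) g) = chain_ext (\<phi> n) (D g))"

definition cocycle_on :: "(nat \<Rightarrow> 'g set) \<Rightarrow> ('g \<Rightarrow> ('g \<Rightarrow>\<^sub>0 'a::ring_1)) \<Rightarrow> nat \<Rightarrow> ('g \<Rightarrow> 'a) \<Rightarrow> bool" where
  "cocycle_on G D n f \<longleftrightarrow> (\<forall>g\<in>G (Suc n). pairing f (D g) = 0)"

text \<open>No cochains enter degree 0, so there the value 0 leaves zero as the only
  coboundary.\<close>

definition cobound :: "('g \<Rightarrow> ('g \<Rightarrow>\<^sub>0 'a::ring_1)) \<Rightarrow> nat \<Rightarrow> ('g \<Rightarrow> 'a) \<Rightarrow> ('g \<Rightarrow> 'a)" where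
  "cobound D n u g = (case n of 0 \<Rightarrow> 0 | Suc _ \<Rightarrow> pairing u (D g))"

definition coboundary_on :: "(nat \<Rightarrow> 'g set) \<Rightarrow> ('g \<Rightarrow> ('g \<Rightarrow>\<^sub>0 'a::ring_1)) \<Rightarrow> nat \<Rightarrow> ('g \<Rightarrow> 'a) \<Rightarrow> bool" where
  "coboundary_on G D n f \<longleftrightarrow> (\<exists>u. \<forall>g\<in>G n. f g = cobound D n u g)"

lemma cobound_add: "cobound D n (\<lambda>g. u g + v g) g = cobound D n u g + cobound D n v g"
  by (simp add: cobound_def pair.lin_ext_add_fun split: nat.split)

lemma cobound_diff: "cobound D n (\<lambda>g. u g - v g) g = cobound D n u g - cobound D n v g"
  by (simp add: cobound_def pair.lin_ext_diff_fun split: nat.split)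

lemma cobound_mult: "cobound D n (\<lambda>g. u g * a) g = cobound D n u g * a"
  by (simp add: cobound_def pairing_mult_right split: nat.split)

lemma cobound_zero: "cobound D n (\<lambda>_. 0) g = 0"
  by (simp add: cobound_def split: nat.split)

lemma cocycle_on_add: "cocycle_on G D n f \<Longrightarrow> cocycle_on G D n g \<Longrightarrow> cocycle_on G D n (\<lambda>x. f x + g x)"
  by (simp add: cocycle_on_def pair.lin_ext_add_fun)

lemma cocycle_on_diff: "cocycle_on G D n f \<Longrightarrow> cocycle_on G D n g \<Longrightarrow> cocycle_on G D n (\<lambda>x. f x - g x)"
  by (simp add: cocycle_on_def pair.lin_ext_diff_fun)

lemma cocycle_on_mult: "cocycle_on G D n f \<Longrightarrow> cocycle_on G D n (\<lambda>x. f x * a)"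
  by (simp add: cocycle_on_def pairing_mult_right)

lemma cocycle_on_zero: "cocycle_on G D n (\<lambda>_. 0)"
  by (simp add: cocycle_on_def)

lemma coboundary_onI: "(\<And>g. g \<in> G n \<Longrightarrow> f g = cobound D n u g) \<Longrightarrow> coboundary_on G D n f"
  by (auto simp: coboundary_on_def)

lemma coboundary_onE:
  assumes "coboundary_on G D n f"
  obtains u where "\<And>g. g \<in> G n \<Longrightarrow> f g = cobound D n u g"
  using assms by (auto simp: coboundary_on_def)

lemma coboundary_on_add:
  assumes "coboundary_on G D n f" "coboundary_on G D n f'"
  shows "coboundary_on G D n (\<lambda>x. f x + f' x)"
proof -
  obtain u v where "\<And>g. g \<in> G n \<Longrightarrow> f g = cobound D n u g" "\<And>g. g \<in> G n \<Longrightarrow> f' g = cobound D n v g"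
    using assms by (auto elim!: coboundary_onE)
  then show ?thesis
    by (intro coboundary_onI[where u = "\<lambda>g. u g + v g"]) (simp add: cobound_add)
qed

lemma coboundary_on_diff:
  assumes "coboundary_on G D n f" "coboundary_on G D n f'"
  shows "coboundary_on G D n (\<lambda>x. f x - f' x)"
proof -
  obtain u v where "\<And>g. g \<in> G n \<Longrightarrow> f g = cobound D n u g" "\<And>g. g \<in> G n \<Longrightarrow> f' g = cobound D n v g"
    using assms by (auto elim!: coboundary_onE)
  then show ?thesis
    by (intro coboundary_onI[where u = "\<lambda>g. u g - v g"]) (simp add: cobound_diff)
qed

lemma coboundary_on_mult:
  assumes "coboundary_on G D n f"
  shows "coboundary_on G D n (\<lambda>x. f x * a)"
proof -
  obtain u where "\<And>g. g \<in> G n \<Longrightarrow> f g = cobound D n u g"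
    using assms by (rule coboundary_onE) blast
  then show ?thesis
    by (intro coboundary_onI[where u = "\<lambda>g. u g * a"]) (simp add: cobound_mult)
qed

lemma coboundary_on_zero: "coboundary_on G D n (\<lambda>_. 0)"
  by (rule coboundary_onI[where u = "\<lambda>_. 0"]) (simp add: cobound_zero)

lemma coboundary_on_diff_commute:
  assumes "coboundary_on G D n (\<lambda>x. f x - f' x)"
  shows "coboundary_on G D n (\<lambda>x. f' x - f x)"
  using coboundary_on_diff[OF coboundary_on_zero assms] by simp

lemma coboundary_on_cong:
  assumes "coboundary_on G D n f" "\<And>g. g \<in> G n \<Longrightarrow> f g = f' g"
  shows "coboundary_on G D n f'"
  using assms unfolding coboundary_on_def by simp

lemma cocycle_on_pairing:
  assumes "cocycle_on G D n f" "Poly_Mapping.keys q \<subseteq> G (Suc n)"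
  shows "pairing f (chain_ext D q) = 0"
  using assms
  by (subst pair.lin_ext_chain_ext, subst pair.lin_ext_cong[where f' = "\<lambda>_. 0"])
    (auto simp: cocycle_on_def)

lemma (in free_resolution) cocycle_on_cobound: "cocycle_on G D n (cobound D n u)"
proof (cases n)
  case (Suc m)
  have "pairing (cobound D n u) (D g) = 0" if "g \<in> G (Suc n)" for g
    using D_D[of g m] that Suc pair.lin_ext_chain_ext[of u D "D g"]
    by (simp add: cobound_def[abs_def])
  then show ?thesis by (simp add: cocycle_on_def)
qed (simp add: cocycle_on_def cobound_def[abs_def])

text \<open>Boundaries of generators of degree n + 1 are supported on \<open>G n\<close>, so values
  of a cochain elsewhere do not matter.\<close>

lemma (in free_resolution) cocycle_on_cong:
  assumes "cocycle_on G D n f" "\<And>g. g \<in> G n \<Longrightarrow> f g = f' g"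
  shows "cocycle_on G D n f'"
  unfolding cocycle_on_def
proof
  fix g assume "g \<in> G (Suc n)"
  then have "pairing f' (D g) = pairing f (D g)"
    using assms(2) keys_D[of g n] by (intro pair.lin_ext_cong) auto
  then show "pairing f' (D g) = 0"
    using assms(1) \<open>g \<in> G (Suc n)\<close> by (simp add: cocycle_on_def)
qed

locale two_resolutions =
  R: free_resolution act G D e + R': free_resolution act G' D' e'
  for act :: "'a::ring_1 \<Rightarrow> 'm::ab_group_add \<Rightarrow> 'm"
    and G :: "nat \<Rightarrow> 'g set" and D e and G' :: "nat \<Rightarrow> 'g' set" and D' e'
begin

text \<open>Freeness allows a choice on each generator, and exactness of the target supplies the
  value. The invariant \<open>P\<close> records that cycles go to cycles, because exactness applies
  to the image of \<open>D g\<close> only once that image is known to be a cycle.\<close>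

lemma chain_map_exists: "\<exists>\<phi>. chain_map act G D e G' D' e' \<phi>"
proof -
  define P :: "nat \<Rightarrow> ('g \<Rightarrow> ('g' \<Rightarrow>\<^sub>0 'a)) \<Rightarrow> bool" where
    "P = (\<lambda>n \<phi>. (\<forall>g\<in>G n. Poly_Mapping.keys (\<phi> g) \<subseteq> G' n) \<and>
       (n = 0 \<longrightarrow> (\<forall>g\<in>G 0. lin_ext act e' (\<phi> g) = e g)) \<and>
       (\<forall>p. is_cycle act G D e n p \<longrightarrow> is_cycle act G' D' e' n (chain_ext \<phi> p)))"
  define Q :: "nat \<Rightarrow> ('g \<Rightarrow> ('g' \<Rightarrow>\<^sub>0 'a)) \<Rightarrow> ('g \<Rightarrow> ('g' \<Rightarrow>\<^sub>0 'a)) \<Rightarrow> bool" where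
    "Q = (\<lambda>n \<phi> \<phi>'. \<forall>g\<in>G (Suc n). chain_ext D' (\<phi>' g) = chain_ext \<phi> (D g))"
  have keys: "Poly_Mapping.keys (chain_ext \<phi> p) \<subseteq> G' n"
    if "\<forall>g\<in>G n. Poly_Mapping.keys (\<phi> g) \<subseteq> G' n" "Poly_Mapping.keys p \<subseteq> G n" for \<phi> p n
    using that by (intro keys_chain_ext) auto
  have "\<exists>\<phi>. \<forall>n. P n (\<phi> n) \<and> Q n (\<phi> n) (\<phi> (Suc n))"
  proof (rule dependent_nat_choice)
    obtain \<phi> where \<phi>: "\<And>g. Poly_Mapping.keys (\<phi> g) \<subseteq> G' 0 \<and> lin_ext act e' (\<phi> g) = e g"
      using R'.augmentation_onto[of "e _"] by metis
    have "is_cycle act G' D' e' 0 (chain_ext \<phi> p)" if "is_cycle act G D e 0 p" for p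
      using that \<phi> keys[of 0 \<phi> p] by (simp add: is_cycle_def R.lin_ext_chain_ext)
    then show "\<exists>\<phi>. P 0 \<phi>"
      using \<phi> unfolding P_def by blast
  next
    fix \<phi> n assume P: "P n \<phi>"
    have "\<exists>q. Poly_Mapping.keys q \<subseteq> G' (Suc n) \<and> chain_ext D' q = chain_ext \<phi> (D g)"
      if "g \<in> G (Suc n)" for g
      using P R.D_cycle[OF that] unfolding P_def by (intro R'.exact) blast
    then obtain \<phi>' where \<phi>': "\<And>g. g \<in> G (Suc n) \<Longrightarrow>
        Poly_Mapping.keys (\<phi>' g) \<subseteq> G' (Suc n) \<and> chain_ext D' (\<phi>' g) = chain_ext \<phi> (D g)"
      by metis
    have "is_cycle act G' D' e' (Suc n) (chain_ext \<phi>' p)" if p: "is_cycle act G D e (Suc n) p" for p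
    proof -
      have "chain_ext D' (chain_ext \<phi>' p) = chain_ext (\<lambda>g. chain_ext \<phi> (D g)) p"
        unfolding chain.lin_ext_chain_ext using p \<phi>'
        by (intro chain.lin_ext_cong) (auto simp: is_cycle_def)
      also have "\<dots> = chain_ext \<phi> (chain_ext D p)"
        by (simp add: chain.lin_ext_chain_ext)
      also have "\<dots> = 0"
        using p by (simp add: is_cycle_def)
      finally show ?thesis
        using p \<phi>' keys[of "Suc n" \<phi>' p] by (simp add: is_cycle_def)
    qed
    then show "\<exists>\<phi>'. P (Suc n) \<phi>' \<and> Q n \<phi> \<phi>'"
      using \<phi>' by (intro exI[of _ \<phi>']) (simp add: P_def Q_def)
  qed
  then obtain \<phi> where "\<And>n. P n (\<phi> n)" "\<And>n. Q n (\<phi> n) (\<phi> (Suc n))"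
    by blast
  then have "chain_map act G D e G' D' e' \<phi>"
    unfolding chain_map_def P_def Q_def by blast
  then show ?thesis by (rule exI[of _ \<phi>])
qed

text \<open>The homotopy is built degree by degree. The last clause of \<open>P\<close>, the
  homotopy identity on cycles, applies to the cycle \<open>D g\<close> and shows that the next
  remainder is a cycle, so that it can be filled in the target.\<close>

lemma chain_maps_homotopic:
  assumes \<phi>: "chain_map act G D e G' D' e' \<phi>" and \<psi>: "chain_map act G D e G' D' e' \<psi>"
  shows "\<exists>s. (\<forall>n. \<forall>g\<in>G n. Poly_Mapping.keys (s n g) \<subseteq> G' (Suc n)) \<and>
     (\<forall>g\<in>G 0. chain_ext D' (s 0 g) = \<phi> 0 g - \<psi> 0 g) \<and>
     (\<forall>n. \<forall>g\<in>G (Suc n). chain_ext D' (s (Suc n) g) =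
        \<phi> (Suc n) g - \<psi> (Suc n) g - chain_ext (s n) (D g))"
proof -
  define P :: "nat \<Rightarrow> ('g \<Rightarrow> ('g' \<Rightarrow>\<^sub>0 'a)) \<Rightarrow> bool" where
    "P = (\<lambda>n s. (\<forall>g\<in>G n. Poly_Mapping.keys (s g) \<subseteq> G' (Suc n)) \<and>
       (n = 0 \<longrightarrow> (\<forall>g\<in>G 0. chain_ext D' (s g) = \<phi> 0 g - \<psi> 0 g)) \<and>
       (\<forall>p. is_cycle act G D e n p \<longrightarrow>
          chain_ext D' (chain_ext s p) = chain_ext (\<phi> n) p - chain_ext (\<psi> n) p))"
  define Q :: "nat \<Rightarrow> ('g \<Rightarrow> ('g' \<Rightarrow>\<^sub>0 'a)) \<Rightarrow> ('g \<Rightarrow> ('g' \<Rightarrow>\<^sub>0 'a)) \<Rightarrow> bool" where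
    "Q = (\<lambda>n s s'. \<forall>g\<in>G (Suc n). chain_ext D' (s' g) =
       \<phi> (Suc n) g - \<psi> (Suc n) g - chain_ext s (D g))"
  have keys: "Poly_Mapping.keys (\<phi> n g - \<psi> n g) \<subseteq> G' n" if "g \<in> G n" for n g
    using \<phi> \<psi> that by (intro keys_minus_subset) (auto simp: chain_map_def)
  have "\<exists>s. \<forall>n. P n (s n) \<and> Q n (s n) (s (Suc n))"
  proof (rule dependent_nat_choice)
    have "\<exists>q. Poly_Mapping.keys q \<subseteq> G' (Suc 0) \<and> chain_ext D' q = \<phi> 0 g - \<psi> 0 g" if "g \<in> G 0" for g
      using \<phi> \<psi> keys[OF that] that
      by (intro R'.exact) (auto simp: is_cycle_def chain_map_def R.lin_ext_diff)
    then obtain s where s: "\<And>g. g \<in> G 0 \<Longrightarrow>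
        Poly_Mapping.keys (s g) \<subseteq> G' (Suc 0) \<and> chain_ext D' (s g) = \<phi> 0 g - \<psi> 0 g"
      by metis
    have "chain_ext D' (chain_ext s p) = chain_ext (\<phi> 0) p - chain_ext (\<psi> 0) p"
      if "is_cycle act G D e 0 p" for p
      unfolding chain.lin_ext_chain_ext chain.lin_ext_diff_fun[symmetric] using that s
      by (intro chain.lin_ext_cong) (auto simp: is_cycle_def)
    then show "\<exists>s. P 0 s"
      using s by (intro exI[of _ s]) (simp add: P_def)
  next
    fix s n assume P: "P n s"
    let ?r = "\<lambda>g. \<phi> (Suc n) g - \<psi> (Suc n) g - chain_ext s (D g)"
    have "\<exists>q. Poly_Mapping.keys q \<subseteq> G' (Suc (Suc n)) \<and> chain_ext D' q = ?r g"
      if g: "g \<in> G (Suc n)" for g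
    proof (rule R'.exact)
      have "Poly_Mapping.keys (chain_ext s (D g)) \<subseteq> G' (Suc n)"
        using P R.keys_D[OF g] by (intro keys_chain_ext) (auto simp: P_def)
      then have "Poly_Mapping.keys (?r g) \<subseteq> G' (Suc n)"
        by (rule keys_minus_subset[OF keys[OF g]])
      moreover have "chain_ext D' (chain_ext s (D g)) = chain_ext (\<phi> n) (D g) - chain_ext (\<psi> n) (D g)"
        using P R.D_cycle[OF g] by (simp add: P_def)
      moreover have "chain_ext D' (\<phi> (Suc n) g) = chain_ext (\<phi> n) (D g)"
          "chain_ext D' (\<psi> (Suc n) g) = chain_ext (\<psi> n) (D g)"
        using \<phi> \<psi> g by (simp_all add: chain_map_def)
      ultimately show "is_cycle act G' D' e' (Suc n) (?r g)"
        by (simp add: is_cycle_def chain.lin_ext_diff)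
    qed
    then obtain s' where s': "\<And>g. g \<in> G (Suc n) \<Longrightarrow>
        Poly_Mapping.keys (s' g) \<subseteq> G' (Suc (Suc n)) \<and> chain_ext D' (s' g) = ?r g"
      by metis
    have "chain_ext D' (chain_ext s' p) = chain_ext (\<phi> (Suc n)) p - chain_ext (\<psi> (Suc n)) p"
      if p: "is_cycle act G D e (Suc n) p" for p
    proof -
      have "chain_ext D' (chain_ext s' p) = chain_ext ?r p"
        unfolding chain.lin_ext_chain_ext using p s'
        by (intro chain.lin_ext_cong) (auto simp: is_cycle_def)
      also have "\<dots> = chain_ext (\<phi> (Suc n)) p - chain_ext (\<psi> (Suc n)) p - chain_ext s (chain_ext D p)"
        by (simp add: chain.lin_ext_diff_fun chain.lin_ext_chain_ext)
      finally show ?thesis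
        using p by (simp add: is_cycle_def)
    qed
    then show "\<exists>s'. P (Suc n) s' \<and> Q n s s'"
      using s' by (intro exI[of _ s']) (simp add: P_def Q_def)
  qed
  then obtain s where s: "\<And>n. P n (s n)" "\<And>n. Q n (s n) (s (Suc n))"
    by blast
  show ?thesis
    using s unfolding P_def Q_def by (intro exI[of _ s]) blast
qed

text \<open>Applying \<open>f\<close> to the homotopy identity kills the term through
  \<open>D'\<close>, since \<open>f\<close> is a cocycle. The remaining term has primitive
  \<open>f\<close> composed with the homotopy of the preceding degree; in degree 0 nothing
  remains.\<close>

lemma chain_maps_agree_on_cohomology:
  assumes "chain_map act G D e G' D' e' \<phi>" "chain_map act G D e G' D' e' \<psi>"
    and f: "cocycle_on G' D' n f"
  shows "coboundary_on G D n (\<lambda>g. pairing f (\<phi> n g) - pairing f (\<psi> n g))"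
proof -
  obtain s where s: "\<forall>n. \<forall>g\<in>G n. Poly_Mapping.keys (s n g) \<subseteq> G' (Suc n)"
     "\<forall>g\<in>G 0. chain_ext D' (s 0 g) = \<phi> 0 g - \<psi> 0 g"
     "\<forall>n. \<forall>g\<in>G (Suc n). chain_ext D' (s (Suc n) g) =
        \<phi> (Suc n) g - \<psi> (Suc n) g - chain_ext (s n) (D g)"
    using chain_maps_homotopic[OF assms(1,2)] by blast
  have z: "pairing f (chain_ext D' (s n g)) = 0" if "g \<in> G n" for g
    using f s(1) that by (intro cocycle_on_pairing) auto
  show ?thesis
  proof (cases n)
    case 0
    have "pairing f (\<phi> 0 g) - pairing f (\<psi> 0 g) = 0" if "g \<in> G 0" for g
      using z[of g] s(2) that 0 by (simp add: pair.lin_ext_diff)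
    then show ?thesis
      by (intro coboundary_onI) (simp add: cobound_def 0)
  next
    case (Suc m)
    have "pairing f (\<phi> n g) - pairing f (\<psi> n g) = pairing (\<lambda>g. pairing f (s m g)) (D g)"
      if "g \<in> G n" for g
      using z[of g] s(3) that Suc by (simp add: pair.lin_ext_diff pair.lin_ext_chain_ext)
    then show ?thesis
      by (intro coboundary_onI) (simp add: cobound_def Suc)
  qed
qed

lemma cocycle_pullback:
  assumes "chain_map act G D e G' D' e' \<phi>" "cocycle_on G' D' n f"
  shows "cocycle_on G D n (\<lambda>g. pairing f (\<phi> n g))"
  unfolding cocycle_on_def
proof
  fix g assume g: "g \<in> G (Suc n)"
  have "pairing (\<lambda>g. pairing f (\<phi> n g)) (D g) = pairing f (chain_ext D' (\<phi> (Suc n) g))"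
    using assms(1) g by (simp add: chain_map_def pair.lin_ext_chain_ext[symmetric])
  also have "\<dots> = 0"
    using assms g by (intro cocycle_on_pairing) (auto simp: chain_map_def)
  finally show "pairing (\<lambda>g. pairing f (\<phi> n g)) (D g) = 0" .
qed

text \<open>If \<open>u\<close> is a primitive of \<open>f\<close>, then \<open>u\<close> composed
  with the chain map one degree lower is a primitive of the pullback.\<close>

lemma coboundary_pullback:
  assumes \<phi>: "chain_map act G D e G' D' e' \<phi>" and "coboundary_on G' D' n f"
  shows "coboundary_on G D n (\<lambda>g. pairing f (\<phi> n g))"
proof -
  obtain u where u: "\<And>g. g \<in> G' n \<Longrightarrow> f g = cobound D' n u g"
    using assms(2) by (rule coboundary_onE) blast
  have *: "pairing f (\<phi> n g) = pairing (cobound D' n u) (\<phi> n g)" if "g \<in> G n" for g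
    using \<phi> that u by (intro pair.lin_ext_cong) (auto simp: chain_map_def)
  show ?thesis
  proof (cases n)
    case 0
    then show ?thesis
      using * by (intro coboundary_onI) (simp add: cobound_def[abs_def])
  next
    case (Suc m)
    have "pairing f (\<phi> n g) = pairing (\<lambda>g. pairing u (\<phi> m g)) (D g)" if "g \<in> G n" for g
    proof -
      have "pairing f (\<phi> n g) = pairing u (chain_ext D' (\<phi> n g))"
        using * that Suc by (simp add: cobound_def[abs_def] pair.lin_ext_chain_ext)
      then show ?thesis
        using \<phi> that Suc by (simp add: chain_map_def pair.lin_ext_chain_ext[symmetric])
    qed
    then show ?thesis
      by (intro coboundary_onI) (simp add: cobound_def Suc)
  qed
qed

text \<open>
  Both composites with a chain map \<open>\<psi>\<close> in the other direction are homotopic to the identity,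
  so pullbacks along \<open>\<phi>\<close> and \<open>\<psi>\<close> are mutually inverse on cohomology.
\<close>

lemma pullback_pullback:
  assumes \<phi>: "chain_map act G D e G' D' e' \<phi>" and \<psi>: "chain_map act G' D' e' G D e \<psi>"
    and f: "cocycle_on G D n f"
  shows "coboundary_on G D n (\<lambda>g. pairing (\<lambda>g. pairing f (\<psi> n g)) (\<phi> n g) - f g)"
proof -
  interpret S: two_resolutions act G D e G D e ..
  let ?\<chi> = "\<lambda>n g. chain_ext (\<psi> n) (\<phi> n g)"
  have "chain_map act G D e G D e ?\<chi>"
    unfolding chain_map_def
  proof (intro conjI allI ballI)
    fix n g assume "g \<in> G n"
    then show "Poly_Mapping.keys (?\<chi> n g) \<subseteq> G n"
      using \<phi> \<psi> unfolding chain_map_def by (intro keys_chain_ext) blast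
  next
    fix g assume g: "g \<in> G 0"
    have "lin_ext act e (?\<chi> 0 g) = lin_ext act (\<lambda>g. lin_ext act e (\<psi> 0 g)) (\<phi> 0 g)"
      by (rule R.lin_ext_chain_ext)
    also have "\<dots> = lin_ext act e' (\<phi> 0 g)"
      using \<phi> \<psi> g unfolding chain_map_def by (intro R.lin_ext_cong) blast
    finally show "lin_ext act e (?\<chi> 0 g) = e g"
      using \<phi> g by (simp add: chain_map_def)
  next
    fix n g assume g: "g \<in> G (Suc n)"
    have "chain_ext D (?\<chi> (Suc n) g) = chain_ext (\<lambda>g. chain_ext D (\<psi> (Suc n) g)) (\<phi> (Suc n) g)"
      by (rule chain.lin_ext_chain_ext)
    also have "\<dots> = chain_ext (\<lambda>g. chain_ext (\<psi> n) (D' g)) (\<phi> (Suc n) g)"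
      using \<phi> \<psi> g unfolding chain_map_def by (intro chain.lin_ext_cong) blast
    also have "\<dots> = chain_ext (\<psi> n) (chain_ext D' (\<phi> (Suc n) g))"
      by (simp add: chain.lin_ext_chain_ext)
    also have "\<dots> = chain_ext (\<psi> n) (chain_ext (\<phi> n) (D g))"
      using \<phi> g by (simp add: chain_map_def)
    finally show "chain_ext D (?\<chi> (Suc n) g) = chain_ext (?\<chi> n) (D g)"
      by (simp add: chain.lin_ext_chain_ext)
  qed
  moreover have "chain_map act G D e G D e (\<lambda>n g. Poly_Mapping.single g 1)"
    by (simp add: chain_map_def chain_ext_single R.act_one chain.act_one)
  ultimately show ?thesis
    using S.chain_maps_agree_on_cohomology[of ?\<chi> "\<lambda>n g. Poly_Mapping.single g 1" n f] f
    by (simp add: pair.lin_ext_chain_ext)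
qed

lemma reverse: "two_resolutions act G' D' e' G D e" ..

text \<open>Injectivity on cohomology: pulling back once more along a chain map
  \<open>\<psi>\<close> in the other direction returns \<open>f\<close> up to a coboundary.\<close>

lemma coboundary_pullback_iff:
  assumes \<phi>: "chain_map act G D e G' D' e' \<phi>" and f: "cocycle_on G' D' n f"
  shows "coboundary_on G D n (\<lambda>g. pairing f (\<phi> n g)) \<longleftrightarrow> coboundary_on G' D' n f"
proof
  interpret R: two_resolutions act G' D' e' G D e by (rule reverse)
  obtain \<psi> where \<psi>: "chain_map act G' D' e' G D e \<psi>"
    using R.chain_map_exists by blast
  assume "coboundary_on G D n (\<lambda>g. pairing f (\<phi> n g))"
  then have "coboundary_on G' D' n (\<lambda>g. pairing (\<lambda>g. pairing f (\<phi> n g)) (\<psi> n g))"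
    by (rule R.coboundary_pullback[OF \<psi>])
  from coboundary_on_diff[OF this R.pullback_pullback[OF \<psi> \<phi> f]]
  show "coboundary_on G' D' n f"
    by simp
qed (rule coboundary_pullback[OF \<phi>])

lemma cocycle_pullback_onto:
  assumes \<phi>: "chain_map act G D e G' D' e' \<phi>" and f: "cocycle_on G D n f"
  shows "\<exists>f'. cocycle_on G' D' n f' \<and> coboundary_on G D n (\<lambda>g. pairing f' (\<phi> n g) - f g)"
proof -
  interpret R: two_resolutions act G' D' e' G D e by (rule reverse)
  obtain \<psi> where \<psi>: "chain_map act G' D' e' G D e \<psi>"
    using R.chain_map_exists by blast
  show ?thesis
    using R.cocycle_pullback[OF \<psi> f] pullback_pullback[OF \<phi> \<psi> f] by blast
qed

end


section \<open>Ext through cochains on generators\<close>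

definition gen_boundary :: "('a::ring_1, 'm) gen \<Rightarrow> ('a, 'm) chain" where
  "gen_boundary g = (case g of Base m \<Rightarrow> 0 | Syz l \<Rightarrow> lincomb l)"

definition gen_augmentation :: "('a, 'm::zero) gen \<Rightarrow> 'm" where
  "gen_augmentation g = (case g of Base m \<Rightarrow> m | Syz l \<Rightarrow> 0)"

lemma boundary_eq: "boundary = chain_ext gen_boundary"
  by (simp add: boundary_def gen_boundary_def[abs_def])

lemma augmentation_eq: "augmentation act = lin_ext act gen_augmentation"
  by (simp add: augmentation_def gen_augmentation_def[abs_def])

lemma standard_free_resolution:
  assumes "left_module act"
  shows "free_resolution act (gens act) gen_boundary gen_augmentation"
proof -
  interpret left_module act by fact
  have cyc: "is_cycle act (gens act) gen_boundary gen_augmentation n p \<longleftrightarrow>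
      p \<in> resolution act n \<and> (if n = 0 then augmentation act p = 0 else boundary p = 0)" for n p
    by (simp add: is_cycle_def resolution_def boundary_eq augmentation_eq)
  show ?thesis
  proof
    show "\<exists>p. Poly_Mapping.keys p \<subseteq> gens act 0 \<and> lin_ext act gen_augmentation p = m" for m
    proof -
      have "m \<in> augmentation act ` resolution act 0"
        using augmentation_surj[OF assms] by simp
      then show ?thesis
        by (auto simp: resolution_def augmentation_eq)
    qed
    show "is_cycle act (gens act) gen_boundary gen_augmentation n (gen_boundary g)"
      if "g \<in> gens act (Suc n)" for g n
    proof -
      have "Poly_Mapping.single g 1 \<in> resolution act (Suc n)"
        using that by (simp add: resolution_def del: gens.simps)
      from boundary_in_kernel[OF assms this] show ?thesis
        by (simp add: cyc boundary_eq chain.act_one split: if_splits)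
    qed
    show "\<exists>q. Poly_Mapping.keys q \<subseteq> gens act (Suc n) \<and> chain_ext gen_boundary q = p"
      if "is_cycle act (gens act) gen_boundary gen_augmentation n p" for n p
    proof -
      have "p \<in> boundary ` resolution act (Suc n)"
        using that standard_resolution_exact[OF assms] by (cases n) (auto simp: cyc)
      then show ?thesis
        unfolding resolution_def boundary_eq by blast
    qed
  qed
qed

text \<open>The value 0 outside the resolution follows the convention of \<open>cochains\<close>, so
  a cochain and the restriction of \<open>f\<close> to \<open>gens act n\<close> determine each
  other.\<close>

definition cochain_of ::
  "('a::ring_1 \<Rightarrow> 'm::ab_group_add \<Rightarrow> 'm) \<Rightarrow> nat \<Rightarrow> (('a, 'm) gen \<Rightarrow> 'a) \<Rightarrow> ('a, 'm) chain \<Rightarrow> 'a" where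
  "cochain_of act n f = (\<lambda>p. if p \<in> resolution act n then pairing f p else 0)"

lemma single_in_resolution: "g \<in> gens act n \<Longrightarrow> Poly_Mapping.single g a \<in> resolution act n"
  by (auto simp: resolution_def)

lemma add_in_resolution: "p \<in> resolution act n \<Longrightarrow> q \<in> resolution act n \<Longrightarrow> p + q \<in> resolution act n"
  using keys_add[of p q] by (auto simp: resolution_def)

lemma scale_in_resolution: "p \<in> resolution act n \<Longrightarrow> scale_chain a p \<in> resolution act n"
  using keys_scale_chain[of a p] by (auto simp: resolution_def)

lemma cochain_of_eq_iff: "cochain_of act n f = cochain_of act n f' \<longleftrightarrow> (\<forall>g\<in>gens act n. f g = f' g)"
proof
  assume eq: "cochain_of act n f = cochain_of act n f'"
  show "\<forall>g\<in>gens act n. f g = f' g"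
  proof
    fix g assume "g \<in> gens act n"
    then show "f g = f' g"
      using fun_cong[OF eq, of "Poly_Mapping.single g 1"]
      by (simp add: cochain_of_def single_in_resolution)
  qed
next
  assume "\<forall>g\<in>gens act n. f g = f' g"
  then show "cochain_of act n f = cochain_of act n f'"
    by (auto simp: cochain_of_def fun_eq_iff resolution_def intro!: pair.lin_ext_cong)
qed

lemma cochain_of_add: "cochain_of act n (\<lambda>g. f g + f' g) = (\<lambda>p. cochain_of act n f p + cochain_of act n f' p)"
  by (auto simp: cochain_of_def pair.lin_ext_add_fun)

lemma cochain_of_mult: "cochain_of act n (\<lambda>g. f g * a) = (\<lambda>p. cochain_of act n f p * a)"
  by (auto simp: cochain_of_def pairing_mult_right)

lemma cochain_of_zero: "cochain_of act n (\<lambda>_. 0) = (\<lambda>_. 0)"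
  by (auto simp: cochain_of_def)

lemma cochains_eq: "cochains act n = range (cochain_of act n)"
proof
  show "range (cochain_of act n) \<subseteq> cochains act n"
    by (auto simp: cochains_def cochain_of_def add_in_resolution scale_in_resolution
        pair.lin_ext_add pair.lin_ext_scale)
next
  show "cochains act n \<subseteq> range (cochain_of act n)"
  proof
    fix F assume F: "F \<in> cochains act n"
    let ?f = "\<lambda>g. F (Poly_Mapping.single g 1)"
    have scale: "F (scale_chain a p) = a * F p" if "p \<in> resolution act n" for a p
      using F that by (simp add: cochains_def)
    have "(0 :: ('a, 'b) chain) \<in> resolution act n"
      by (simp add: resolution_def)
    from scale[OF this, of 0] have F0: "F 0 = 0"
      by simp
    \<comment> \<open>\<open>F\<close> is additive only inside the resolution, so membership of the
      partial sums is carried through the induction.\<close>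
    have sum: "sum t S \<in> resolution act n \<and> F (sum t S) = (\<Sum>x\<in>S. F (t x))"
      if "finite S" "\<forall>x\<in>S. t x \<in> resolution act n" for t and S :: "('a, 'b) gen set"
      using that
    proof (induction S rule: finite_induct)
      case empty
      then show ?case by (simp add: F0 resolution_def)
    next
      case (insert x S)
      have "F (t x + sum t S) = F (t x) + F (sum t S)"
        using F insert by (simp add: cochains_def)
      then show ?case
        using insert by (simp add: add_in_resolution)
    qed
    have "F p = pairing ?f p" if p: "p \<in> resolution act n" for p
    proof -
      let ?t = "\<lambda>g. scale_chain (Poly_Mapping.lookup p g) (Poly_Mapping.single g 1)"
      have single: "Poly_Mapping.single g 1 \<in> resolution act n" if "g \<in> Poly_Mapping.keys p" for g
        using p that by (intro single_in_resolution) (auto simp: resolution_def)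
      have "sum ?t (Poly_Mapping.keys p) = p"
        using chain_ext_single[of p] by (simp add: lin_ext_def)
      then have "F p = (\<Sum>g\<in>Poly_Mapping.keys p. F (?t g))"
        using sum[of "Poly_Mapping.keys p" ?t] single by (simp add: scale_in_resolution)
      also have "\<dots> = pairing ?f p"
        unfolding lin_ext_def using single by (intro sum.cong) (simp_all add: scale)
      finally show ?thesis .
    qed
    moreover have "F p = 0" if "p \<notin> resolution act n" for p
      using F that by (simp add: cochains_def)
    ultimately have "F = cochain_of act n ?f"
      by (auto simp: cochain_of_def fun_eq_iff)
    then show "F \<in> range (cochain_of act n)"
      by blast
  qed
qed

text \<open>The boundary maps \<open>resolution act (Suc n)\<close> into
  \<open>resolution act n\<close>, so the default value 0 of the inner cochain is never met.\<close>

lemma coboundary_cochain_of: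
  assumes "left_module act"
  shows "coboundary act n (cochain_of act n f) =
    cochain_of act (Suc n) (\<lambda>g. pairing f (gen_boundary g))"
  using boundary_in_kernel(1)[OF assms]
  by (auto simp: coboundary_def cochain_of_def boundary_eq pair.lin_ext_chain_ext fun_eq_iff)

lemma cocycles_eq:
  assumes "left_module act"
  shows "cocycles act n = {cochain_of act n f |f. cocycle_on (gens act) gen_boundary n f}"
proof -
  have "coboundary act n (cochain_of act n f) = (\<lambda>_. 0) \<longleftrightarrow> cocycle_on (gens act) gen_boundary n f" for f
    using cochain_of_eq_iff[of act "Suc n" "\<lambda>g. pairing f (gen_boundary g)" "\<lambda>_. 0"]
    by (simp add: coboundary_cochain_of[OF assms] cochain_of_zero cocycle_on_def)
  then show ?thesis
    unfolding cocycles_def cochains_eq by auto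
qed

lemma coboundaries_eq:
  assumes "left_module act"
  shows "coboundaries act n = {cochain_of act n f |f. coboundary_on (gens act) gen_boundary n f}"
proof -
  have "coboundaries act n = (\<lambda>u. cochain_of act n (cobound gen_boundary n u)) ` UNIV"
    using coboundary_cochain_of[OF assms]
    by (cases n)
      (simp_all add: coboundaries_def cochains_eq cobound_def[abs_def] cochain_of_zero image_image)
  also have "\<dots> = {cochain_of act n f |f. coboundary_on (gens act) gen_boundary n f}"
  proof (intro equalityI subsetI)
    fix F assume "F \<in> {cochain_of act n f |f. coboundary_on (gens act) gen_boundary n f}"
    then obtain f u where "F = cochain_of act n f" "\<forall>g\<in>gens act n. f g = cobound gen_boundary n u g"
      by (auto simp: coboundary_on_def)
    then have "F = cochain_of act n (cobound gen_boundary n u)"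
      by (simp add: cochain_of_eq_iff)
    then show "F \<in> (\<lambda>u. cochain_of act n (cobound gen_boundary n u)) ` UNIV"
      by simp
  qed (auto simp: coboundary_on_def)
  finally show ?thesis .
qed

text \<open>The coset of \<open>f\<close> modulo coboundaries, described through functions on
  generators. It is defined for every \<open>f\<close>, cocycle or not, which frees the criterion
  for equality of classes from side conditions.\<close>

definition ext_class ::
  "nat \<Rightarrow> ('a::ring_1 \<Rightarrow> 'm::ab_group_add \<Rightarrow> 'm) \<Rightarrow> (('a, 'm) gen \<Rightarrow> 'a) \<Rightarrow> (('a, 'm) chain \<Rightarrow> 'a) set" where
  "ext_class n act f =
     {cochain_of act n f' |f'. coboundary_on (gens act) gen_boundary n (\<lambda>g. f' g - f g)}"

context left_module
begin

lemma coset_ext_class: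
  assumes "Add M = (\<lambda>f g p. f p + g p)"
  shows "coset M (coboundaries act n) (cochain_of act n f) = ext_class n act f"
proof (intro equalityI subsetI)
  fix F assume "F \<in> coset M (coboundaries act n) (cochain_of act n f)"
  then obtain c where "coboundary_on (gens act) gen_boundary n c"
      "F = cochain_of act n (\<lambda>g. f g + c g)"
    by (auto simp: coset_def coboundaries_eq[OF left_module_axioms] cochain_of_add assms)
  then show "F \<in> ext_class n act f"
    by (auto simp: ext_class_def intro!: exI[of _ "\<lambda>g. f g + c g"])
next
  fix F assume "F \<in> ext_class n act f"
  then obtain f' where f': "coboundary_on (gens act) gen_boundary n (\<lambda>g. f' g - f g)"
      "F = cochain_of act n f'"
    by (auto simp: ext_class_def)
  have "F = Add M (cochain_of act n f) (cochain_of act n (\<lambda>g. f' g - f g))"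
    using cochain_of_add[of act n f "\<lambda>g. f' g - f g"] by (simp add: assms f'(2))
  then show "F \<in> coset M (coboundaries act n) (cochain_of act n f)"
    using f'(1) by (auto simp: coset_def coboundaries_eq[OF left_module_axioms])
qed

lemma ext_class_eq_iff:
  "ext_class n act f = ext_class n act f' \<longleftrightarrow>
     coboundary_on (gens act) gen_boundary n (\<lambda>g. f g - f' g)"
proof
  assume "ext_class n act f = ext_class n act f'"
  moreover have "cochain_of act n f \<in> ext_class n act f"
    by (auto simp: ext_class_def coboundary_on_zero intro!: exI[of _ f])
  ultimately obtain f'' where *: "cochain_of act n f = cochain_of act n f''"
      "coboundary_on (gens act) gen_boundary n (\<lambda>g. f'' g - f' g)"
    by (auto simp: ext_class_def)
  show "coboundary_on (gens act) gen_boundary n (\<lambda>g. f g - f' g)"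
    using coboundary_on_cong[OF *(2)] *(1) by (simp add: cochain_of_eq_iff)
next
  assume c: "coboundary_on (gens act) gen_boundary n (\<lambda>g. f g - f' g)"
  have "coboundary_on (gens act) gen_boundary n (\<lambda>g. f'' g - f g) \<longleftrightarrow>
      coboundary_on (gens act) gen_boundary n (\<lambda>g. f'' g - f' g)" for f''
    using coboundary_on_add[OF _ c, of "\<lambda>g. f'' g - f g"]
      coboundary_on_diff[OF _ c, of "\<lambda>g. f'' g - f' g"] by auto
  then show "ext_class n act f = ext_class n act f'"
    by (simp add: ext_class_def)
qed

lemma Carrier_Ext:
  "Carrier (Ext n act) = {ext_class n act f |f. cocycle_on (gens act) gen_boundary n f}"
proof -
  have "{cochain_of act n f |f. cocycle_on (gens act) gen_boundary n f} =
      cochain_of act n ` Collect (cocycle_on (gens act) gen_boundary n)"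
    by auto
  then have "Carrier (Ext n act) = ext_class n act ` Collect (cocycle_on (gens act) gen_boundary n)"
    by (simp add: Ext_def quotient_module_def cocycles_eq[OF left_module_axioms]
        image_image coset_ext_class)
  then show ?thesis
    by auto
qed

lemma Zero_Ext: "Zero (Ext n act) = ext_class n act (\<lambda>_. 0)"
  by (simp add: Ext_def quotient_module_def coboundaries_eq[OF left_module_axioms] ext_class_def)

lemma Add_Ext:
  "Add (Ext n act) (ext_class n act f) (ext_class n act f') = ext_class n act (\<lambda>g. f g + f' g)"
proof -
  have "Add (Ext n act) (ext_class n act f) (ext_class n act f') =
      {\<lambda>p. x p + y p |x y. x \<in> ext_class n act f \<and> y \<in> ext_class n act f'}" (is "_ = ?S")
    by (simp add: Ext_def quotient_module_def)
  also have "?S = ext_class n act (\<lambda>g. f g + f' g)"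
  proof (intro equalityI subsetI)
    fix F assume "F \<in> ?S"
    then obtain a b where "F = cochain_of act n (\<lambda>g. a g + b g)"
        "coboundary_on (gens act) gen_boundary n (\<lambda>g. a g - f g)"
        "coboundary_on (gens act) gen_boundary n (\<lambda>g. b g - f' g)"
      by (auto simp: ext_class_def cochain_of_add)
    then show "F \<in> ext_class n act (\<lambda>g. f g + f' g)"
      using coboundary_on_add[of "gens act" gen_boundary n "\<lambda>g. a g - f g" "\<lambda>g. b g - f' g"]
      by (auto simp: ext_class_def algebra_simps intro!: exI[of _ "\<lambda>g. a g + b g"])
  next
    fix F assume "F \<in> ext_class n act (\<lambda>g. f g + f' g)"
    then obtain a where a: "F = cochain_of act n a"
        "coboundary_on (gens act) gen_boundary n (\<lambda>g. a g - (f g + f' g))"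
      by (auto simp: ext_class_def)
    have "F = (\<lambda>p. cochain_of act n (\<lambda>g. a g - f' g) p + cochain_of act n f' p)"
      using cochain_of_add[of act n "\<lambda>g. a g - f' g" f'] by (simp add: a(1))
    moreover have "cochain_of act n (\<lambda>g. a g - f' g) \<in> ext_class n act f"
      using a(2) by (auto simp: ext_class_def algebra_simps intro!: exI[of _ "\<lambda>g. a g - f' g"])
    moreover have "cochain_of act n f' \<in> ext_class n act f'"
      by (auto simp: ext_class_def coboundary_on_zero intro!: exI[of _ f'])
    ultimately show "F \<in> ?S"
      by blast
  qed
  finally show ?thesis .
qed

text \<open>Right multiplication preserves coboundaries, so the union that defines the action on a
  quotient runs over one and the same coset.\<close>

lemma Act_Ext: "Act (Ext n act) a (ext_class n act f) = ext_class n act (\<lambda>g. f g * a)"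
proof -
  have *: "ext_class n act (\<lambda>g. f' g * a) = ext_class n act (\<lambda>g. f g * a)"
    if "coboundary_on (gens act) gen_boundary n (\<lambda>g. f' g - f g)" for f'
    using coboundary_on_mult[OF that, of a] by (simp add: ext_class_eq_iff algebra_simps)
  have "cochain_of act n f \<in> ext_class n act f"
    by (auto simp: ext_class_def coboundary_on_zero intro!: exI[of _ f])
  then have "(\<Union>x\<in>ext_class n act f. ext_class n act (\<lambda>g. f g * a)) = ext_class n act (\<lambda>g. f g * a)"
    by blast
  moreover have "coset M (coboundaries act n) (\<lambda>p. x p * a) = ext_class n act (\<lambda>g. f g * a)"
    if "x \<in> ext_class n act f" "Add M = (\<lambda>f g p. f p + g p)" for x and M :: "('a, _) gmod"
  proof -
    obtain f' where "x = cochain_of act n f'"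
        "coboundary_on (gens act) gen_boundary n (\<lambda>g. f' g - f g)"
      using \<open>x \<in> _\<close> by (auto simp: ext_class_def)
    with * show ?thesis
      by (simp add: cochain_of_mult[symmetric] coset_ext_class that(2))
  qed
  ultimately show ?thesis
    by (simp add: Ext_def quotient_module_def)
qed

lemma zero_module_Ext_iff:
  "zero_module (Ext n act) \<longleftrightarrow>
     (\<forall>f. cocycle_on (gens act) gen_boundary n f \<longrightarrow> coboundary_on (gens act) gen_boundary n f)"
proof -
  have "zero_module (Ext n act) \<longleftrightarrow>
      (\<forall>f. cocycle_on (gens act) gen_boundary n f \<longrightarrow> ext_class n act f = ext_class n act (\<lambda>_. 0))"
    using cocycle_on_zero[of "gens act" gen_boundary n]
    by (auto simp: zero_module_def Carrier_Ext Zero_Ext)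
  then show ?thesis
    by (simp add: ext_class_eq_iff)
qed

lemma right_module_Ext: "right_module (Ext n act)"
  unfolding right_module_def
proof (intro conjI)
  show "Zero (Ext n act) \<in> Carrier (Ext n act)"
    using cocycle_on_zero by (auto simp: Carrier_Ext Zero_Ext)
  show "\<forall>x\<in>Carrier (Ext n act). \<forall>y\<in>Carrier (Ext n act).
      Add (Ext n act) x y \<in> Carrier (Ext n act) \<and> Add (Ext n act) x y = Add (Ext n act) y x"
  proof (intro ballI conjI)
    fix x y assume "x \<in> Carrier (Ext n act)" "y \<in> Carrier (Ext n act)"
    then obtain f f' where f: "x = ext_class n act f" "cocycle_on (gens act) gen_boundary n f"
        "y = ext_class n act f'" "cocycle_on (gens act) gen_boundary n f'"
      by (auto simp: Carrier_Ext)
    show "Add (Ext n act) x y \<in> Carrier (Ext n act)"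
      unfolding f(1,3) Add_Ext Carrier_Ext using cocycle_on_add[OF f(2,4)] by blast
    show "Add (Ext n act) x y = Add (Ext n act) y x"
      by (simp add: f(1,3) Add_Ext add.commute)
  qed
  show "\<forall>x\<in>Carrier (Ext n act). \<forall>y\<in>Carrier (Ext n act). \<forall>z\<in>Carrier (Ext n act).
      Add (Ext n act) (Add (Ext n act) x y) z = Add (Ext n act) x (Add (Ext n act) y z)"
    by (auto simp: Carrier_Ext Add_Ext add.assoc)
  show "\<forall>x\<in>Carrier (Ext n act). Add (Ext n act) (Zero (Ext n act)) x = x \<and>
      (\<exists>y\<in>Carrier (Ext n act). Add (Ext n act) x y = Zero (Ext n act))"
  proof
    fix x assume "x \<in> Carrier (Ext n act)"
    then obtain f where f: "x = ext_class n act f" "cocycle_on (gens act) gen_boundary n f"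
      by (auto simp: Carrier_Ext)
    have "ext_class n act (\<lambda>g. f g * (- 1)) \<in> Carrier (Ext n act)"
      unfolding Carrier_Ext using cocycle_on_mult[OF f(2), of "- 1"] by blast
    moreover have "Add (Ext n act) x (ext_class n act (\<lambda>g. f g * (- 1))) = Zero (Ext n act)"
      by (simp add: f Add_Ext Zero_Ext)
    ultimately show "Add (Ext n act) (Zero (Ext n act)) x = x \<and>
        (\<exists>y\<in>Carrier (Ext n act). Add (Ext n act) x y = Zero (Ext n act))"
      by (intro conjI bexI) (simp_all add: f(1) Add_Ext Zero_Ext)
  qed
  show "\<forall>a. \<forall>x\<in>Carrier (Ext n act). Act (Ext n act) a x \<in> Carrier (Ext n act)"
  proof (intro allI ballI)
    fix a x assume "x \<in> Carrier (Ext n act)"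
    then obtain f where f: "x = ext_class n act f" "cocycle_on (gens act) gen_boundary n f"
      by (auto simp: Carrier_Ext)
    show "Act (Ext n act) a x \<in> Carrier (Ext n act)"
      unfolding f(1) Act_Ext Carrier_Ext using cocycle_on_mult[OF f(2), of a] by blast
  qed
qed (auto simp: Carrier_Ext Add_Ext Act_Ext distrib_left distrib_right mult.assoc)

end

section \<open>Isomorphisms out of quotient modules, and restriction of scalars\<close>

text \<open>The first isomorphism theorem, with cosets required to be the fibres of
  \<open>\<Theta>\<close> instead of a condition on its kernel. Since \<open>\<Theta>\<close> is
  constant on a coset, its image there is a singleton, whose element is the value of the induced
  map.\<close>

lemma quotient_module_iso:
  assumes surj: "\<Theta> ` Carrier M = Carrier P"
    and fibre: "\<And>x. x \<in> Carrier M \<Longrightarrow> coset M N x = {y \<in> Carrier M. \<Theta> y = \<Theta> x}"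
    and add: "\<And>x y. x \<in> Carrier M \<Longrightarrow> y \<in> Carrier M \<Longrightarrow> \<Theta> (Add M x y) = Add P (\<Theta> x) (\<Theta> y)"
    and act: "\<And>a x. x \<in> Carrier M \<Longrightarrow> Act M a x \<in> Carrier M \<and> \<Theta> (Act M a x) = Act P a (\<Theta> x)"
  shows "quotient_module M N \<cong>\<^sub>m P"
proof -
  define f where "f X = the_elem (\<Theta> ` X)" for X
  have fI: "f X = t" if "X \<noteq> {}" "\<And>x. x \<in> X \<Longrightarrow> \<Theta> x = t" for X t
  proof -
    have "\<Theta> ` X = {t}" using that by auto
    then show ?thesis by (simp add: f_def)
  qed
  have f_coset: "f (coset M N x) = \<Theta> x" if "x \<in> Carrier M" for x
    using that by (intro fI) (auto simp: fibre)
  have inj: "inj_on f (coset M N ` Carrier M)"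
  proof (rule inj_onI)
    fix X Y assume "X \<in> coset M N ` Carrier M" "Y \<in> coset M N ` Carrier M" "f X = f Y"
    then obtain x y where xy: "X = coset M N x" "Y = coset M N y" "x \<in> Carrier M" "y \<in> Carrier M"
      by blast
    then have "\<Theta> x = \<Theta> y"
      using \<open>f X = f Y\<close> by (simp add: f_coset)
    then show "X = Y"
      using xy by (simp add: fibre)
  qed
  moreover have "f ` (coset M N ` Carrier M) = Carrier P"
    by (simp add: surj[symmetric] image_image f_coset)
  moreover have "f {Add M a b |a b. a \<in> coset M N x \<and> b \<in> coset M N y} = Add P (\<Theta> x) (\<Theta> y)"
    if "x \<in> Carrier M" "y \<in> Carrier M" for x y
    using that by (intro fI) (auto simp: fibre add)
  moreover have "f (\<Union>y\<in>coset M N x. coset M N (Act M a y)) = Act P a (\<Theta> x)"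
    if "x \<in> Carrier M" for a x
  proof (rule fI)
    have "Act M a x \<in> coset M N (Act M a x)" "x \<in> coset M N x"
      using that act by (simp_all add: fibre)
    then show "(\<Union>y\<in>coset M N x. coset M N (Act M a y)) \<noteq> {}"
      by blast
  next
    fix z assume "z \<in> (\<Union>y\<in>coset M N x. coset M N (Act M a y))"
    then obtain y where y: "y \<in> coset M N x" "z \<in> coset M N (Act M a y)"
      by blast
    then have "y \<in> Carrier M" "\<Theta> y = \<Theta> x"
      using that by (simp_all add: fibre)
    then show "\<Theta> z = Act P a (\<Theta> x)"
      using y(2) act by (simp add: fibre)
  qed
  ultimately show ?thesis
    unfolding module_iso_def
    by (intro exI[of _ f]) (auto simp: bij_betw_def quotient_module_def f_coset)
qed

lemma right_module_restrict_scalars: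
  fixes \<kappa> :: "'r::comm_ring_1 \<Rightarrow> 'b::ring_1"
  assumes "right_module M" "\<And>x y. \<kappa> (x + y) = \<kappa> x + \<kappa> y" "\<And>x y. \<kappa> (x * y) = \<kappa> x * \<kappa> y" "\<kappa> 1 = 1"
  shows "right_module (restrict_scalars \<kappa> M)"
  using assms(1) unfolding right_module_def restrict_scalars_def gmod.select_convs assms(2-4)
  by blast


section \<open>Reduction of a resolution modulo the formal parameter\<close>

text \<open>
  \<open>\<pi>\<close> is the reduction \<open>A\<^sub>h \<rightarrow> A\<^sub>h/hA\<^sub>h \<cong> A\<^sub>0\<close> and \<open>\<kappa>\<close> the structure map \<open>c \<mapsto> c \<cdot> 1\<close>.  In the
  completeness axiom \<open>S t\<close> plays the role of \<open>\<Sum>n. t n * h ^ n\<close>.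
\<close>

locale formal_deformation =
  fixes \<pi> :: "'b::ring_1 \<Rightarrow> 'a::ring_1" and \<kappa> :: "'k::field fps \<Rightarrow> 'b"
  assumes \<pi>_add: "\<pi> (b + c) = \<pi> b + \<pi> c"
    and \<pi>_mult: "\<pi> (b * c) = \<pi> b * \<pi> c"
    and \<pi>_one: "\<pi> 1 = 1"
    and \<pi>_surj: "\<exists>b. \<pi> b = a"
    and \<kappa>_add: "\<kappa> (x + y) = \<kappa> x + \<kappa> y"
    and \<kappa>_mult: "\<kappa> (x * y) = \<kappa> x * \<kappa> y"
    and \<kappa>_one: "\<kappa> 1 = 1"
    and \<kappa>_central: "\<kappa> x * b = b * \<kappa> x"
    and \<pi>_kernel: "\<pi> b = 0 \<longleftrightarrow> (\<exists>c. b = c * \<kappa> fps_X)"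
    and torsion_free: "b * \<kappa> fps_X = 0 \<Longrightarrow> b = 0"
    and separated: "(\<And>n. t n = t (Suc n) * \<kappa> fps_X) \<Longrightarrow> t 0 = 0"
    and complete: "\<exists>S. \<forall>t. S t = t 0 + S (\<lambda>n. t (Suc n)) * \<kappa> fps_X"
begin

abbreviation h :: 'b where "h \<equiv> \<kappa> fps_X"

definition red :: "('g \<Rightarrow>\<^sub>0 'b) \<Rightarrow> ('g \<Rightarrow>\<^sub>0 'a)" where
  "red p = Poly_Mapping.map \<pi> p"

lemma \<pi>_lift: obtains u where "\<And>g. \<pi> (u g) = v g"
proof -
  have "\<exists>u. \<forall>g. \<pi> (u g) = v g"
    by (rule choice) (simp add: \<pi>_surj)
  then show ?thesis
    using that by blast
qed

lemma \<pi>_zero [simp]: "\<pi> 0 = 0"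
  using \<pi>_add[of 0 0] by simp

lemma \<pi>_diff: "\<pi> (b - c) = \<pi> b - \<pi> c"
  using \<pi>_add[of "b - c" c] by (simp add: algebra_simps)

lemma \<pi>_h [simp]: "\<pi> (b * h) = 0"
  using \<pi>_kernel by blast

lemma lookup_red [simp]: "Poly_Mapping.lookup (red p) g = \<pi> (Poly_Mapping.lookup p g)"
  by (simp add: red_def Poly_Mapping.map.rep_eq when_def)

lemma keys_red: "Poly_Mapping.keys (red p) \<subseteq> Poly_Mapping.keys p"
  by (auto simp: in_keys_iff)

lemma red_add: "red (p + q) = red p + red q"
  by (rule poly_mapping_eqI) (simp add: lookup_add \<pi>_add)

lemma red_diff: "red (p - q) = red p - red q"
  by (rule poly_mapping_eqI) (simp add: lookup_minus \<pi>_diff)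

lemma red_zero [simp]: "red 0 = 0"
  by (rule poly_mapping_eqI) simp

lemma red_scale: "red (scale_chain a p) = scale_chain (\<pi> a) (red p)"
  by (rule poly_mapping_eqI) (simp add: \<pi>_mult)

text \<open>Stated for an arbitrary map \<open>\<sigma>\<close> that is semilinear over
  \<open>\<pi>\<close>, so that one argument covers values of cochains (\<open>\<pi>\<close>),
  chains (\<open>red\<close>) and the augmentation (\<open>\<rho>\<close>).\<close>

lemma lin_ext_red:
  assumes "left_module act" "left_module act'"
    and add: "\<And>x y. \<sigma> (x + y) = \<sigma> x + \<sigma> y" and act: "\<And>b x. \<sigma> (act b x) = act' (\<pi> b) (\<sigma> x)"
  shows "\<sigma> (lin_ext act f p) = lin_ext act' (\<lambda>g. \<sigma> (f g)) (red p)"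
proof -
  interpret L: left_module act by fact
  interpret L': left_module act' by fact
  have zero: "\<sigma> 0 = 0"
    using add[of 0 0] by simp
  have sum: "\<sigma> (sum t S) = (\<Sum>x\<in>S. \<sigma> (t x))" for t S
    by (induction S rule: infinite_finite_induct) (simp_all add: zero add)
  have "lin_ext act' (\<lambda>g. \<sigma> (f g)) (red p) =
      (\<Sum>g\<in>Poly_Mapping.keys p. act' (Poly_Mapping.lookup (red p) g) (\<sigma> (f g)))"
    by (rule L'.lin_ext_superset[OF _ keys_red]) simp
  then show ?thesis
    by (simp add: lin_ext_def[of act] sum act)
qed

lemma pairing_red: "pairing (\<lambda>g. \<pi> (f g)) (red p) = \<pi> (pairing f p)"
  by (rule lin_ext_red[where \<sigma> = \<pi>, OF pair.left_module_axioms pair.left_module_axioms \<pi>_add \<pi>_mult, symmetric])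

lemma chain_ext_red: "chain_ext (\<lambda>g. red (\<phi> g)) (red p) = red (chain_ext \<phi> p)"
  by (rule lin_ext_red[where \<sigma> = red, OF left_module_scale_chain left_module_scale_chain red_add red_scale, symmetric])

lemma red_surj: "\<exists>p. red p = q \<and> Poly_Mapping.keys p \<subseteq> Poly_Mapping.keys q"
proof -
  obtain s where s: "\<And>a. \<pi> (s a) = a"
    using \<pi>_lift[of "\<lambda>a. a"] by blast
  \<comment> \<open>\<open>Poly_Mapping.map\<close> keeps zero coefficients zero whatever
    \<open>s 0\<close> is, so the lift acquires no new keys.\<close>
  let ?p = "Poly_Mapping.map s q"
  have "red ?p = q"
    by (rule poly_mapping_eqI) (simp add: Poly_Mapping.map.rep_eq when_def s)
  moreover have "Poly_Mapping.keys ?p \<subseteq> Poly_Mapping.keys q"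
    by (auto simp: in_keys_iff Poly_Mapping.map.rep_eq when_def)
  ultimately show ?thesis by blast
qed

text \<open>Each coefficient is divisible by h. Torsion freeness forces the quotient to vanish
  wherever \<open>p\<close> does, which keeps the support finite.\<close>

lemma red_eq_0:
  assumes "red p = 0"
  shows "\<exists>q. p = scale_chain h q \<and> Poly_Mapping.keys q \<subseteq> Poly_Mapping.keys p"
proof -
  have "\<exists>c. Poly_Mapping.lookup p g = c * h" for g
    using arg_cong[OF assms, of "\<lambda>q. Poly_Mapping.lookup q g"] \<pi>_kernel by simp
  then obtain c where c: "\<And>g. Poly_Mapping.lookup p g = c g * h"
    by metis
  have c0: "c g = 0" if "Poly_Mapping.lookup p g = 0" for g
    using c[of g] that torsion_free by simp
  have "finite {g. c g \<noteq> 0}"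
  proof (rule finite_subset)
    show "{g. c g \<noteq> 0} \<subseteq> Poly_Mapping.keys p"
      using c0 by (auto simp: in_keys_iff)
  qed simp
  then have lookup: "Poly_Mapping.lookup (Abs_poly_mapping c) g = c g" for g
    by (simp add: Abs_poly_mapping_inverse)
  have "p = scale_chain h (Abs_poly_mapping c)"
    by (rule poly_mapping_eqI) (simp add: lookup c \<kappa>_central)
  moreover have "Poly_Mapping.keys (Abs_poly_mapping c) \<subseteq> Poly_Mapping.keys p"
    using c0 by (auto simp: in_keys_iff lookup)
  ultimately show ?thesis by blast
qed

lemma scale_chain_h_eq_0: "scale_chain h p = 0 \<Longrightarrow> p = 0"
proof (rule poly_mapping_eqI)
  fix k assume "scale_chain h p = 0"
  then have "h * Poly_Mapping.lookup p k = 0"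
    by (metis lookup_scale_chain lookup_zero)
  then show "Poly_Mapping.lookup p k = Poly_Mapping.lookup 0 k"
    using torsion_free \<kappa>_central by simp
qed

lemma red_scale_h [simp]: "red (scale_chain h p) = 0"
  by (rule poly_mapping_eqI) (simp add: \<kappa>_central)

end

text \<open>The axioms on \<open>\<rho>\<close> present the second module as the first modulo h;
  that multiples of h go to 0 follows from \<open>\<rho>_act\<close>, since \<open>\<pi>\<close>
  kills h. In the application \<open>\<rho>\<close> is the constant coefficient, from K to
  k.\<close>

locale deformed_resolution =
  formal_deformation \<pi> \<kappa> + free_resolution act G D e + M0: left_module act0
  for \<pi> :: "'b::ring_1 \<Rightarrow> 'a::ring_1" and \<kappa> :: "'k::field fps \<Rightarrow> 'b"
    and act :: "'b \<Rightarrow> 'm::ab_group_add \<Rightarrow> 'm" and G :: "nat \<Rightarrow> 'g set" and D e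
    and act0 :: "'a \<Rightarrow> 'n::ab_group_add \<Rightarrow> 'n" +
  fixes \<rho> :: "'m \<Rightarrow> 'n"
  assumes \<rho>_add: "\<rho> (x + y) = \<rho> x + \<rho> y"
    and \<rho>_act: "\<rho> (act b x) = act0 (\<pi> b) (\<rho> x)"
    and \<rho>_surj: "\<exists>x. \<rho> x = z"
    and \<rho>_kernel: "\<rho> x = 0 \<Longrightarrow> \<exists>y. x = act h y"
    and act_torsion_free: "act h x = 0 \<Longrightarrow> x = 0"
begin

abbreviation D0 :: "'g \<Rightarrow> ('g \<Rightarrow>\<^sub>0 'a)" where "D0 \<equiv> \<lambda>g. red (D g)"

lemma augmentation_red: "lin_ext act0 (\<lambda>g. \<rho> (e g)) (red p) = \<rho> (lin_ext act e p)"
  by (rule lin_ext_red[where \<sigma> = \<rho>, OF left_module_axioms M0.left_module_axioms \<rho>_add \<rho>_act, symmetric])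

lemma \<rho>_zero [simp]: "\<rho> 0 = 0"
  using \<rho>_add[of 0 0] by simp

lemma is_cycle_red: "is_cycle act G D e n p \<Longrightarrow> is_cycle act0 G D0 (\<lambda>g. \<rho> (e g)) n (red p)"
  using keys_red[of p] by (auto simp: is_cycle_def augmentation_red chain_ext_red)

text \<open>Cycles modulo \<open>h\<close> lift because the resolved module is \<open>h\<close>-torsion free.\<close>

lemma cycle_lift:
  assumes "is_cycle act0 G D0 (\<lambda>g. \<rho> (e g)) n q"
  shows "\<exists>p. is_cycle act G D e n p \<and> red p = q"
proof -
  obtain p where p: "red p = q" "Poly_Mapping.keys p \<subseteq> G n"
    using red_surj[of q] assms by (auto simp: is_cycle_def)
  \<comment> \<open>The outgoing map sends the arbitrary lift \<open>p\<close> to a multiple of h. A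
    preimage \<open>r\<close> of the quotient by h corrects it, and subtracting h times
    \<open>r\<close> leaves the reduction unchanged.\<close>
  have "\<exists>r. Poly_Mapping.keys r \<subseteq> G n \<and> is_cycle act G D e n (p - scale_chain h r)"
  proof (cases n)
    case 0
    have "\<rho> (lin_ext act e p) = 0"
      using assms 0 p(1) by (simp add: is_cycle_def augmentation_red[symmetric])
    then obtain y where y: "lin_ext act e p = act h y"
      using \<rho>_kernel by blast
    obtain r where r: "Poly_Mapping.keys r \<subseteq> G 0" "lin_ext act e r = y"
      using augmentation_onto by blast
    have "is_cycle act G D e 0 (p - scale_chain h r)"
      using keys_minus_subset[of p "G 0" "scale_chain h r"] keys_scale_chain[of h r] p(2) r y 0
      by (auto simp: is_cycle_def lin_ext_diff lin_ext_scale)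
    then show ?thesis
      using r 0 by blast
  next
    case (Suc m)
    have "red (chain_ext D p) = 0"
      using assms p(1) Suc by (simp add: is_cycle_def chain_ext_red[symmetric])
    then obtain s where s: "chain_ext D p = scale_chain h s"
        "Poly_Mapping.keys s \<subseteq> Poly_Mapping.keys (chain_ext D p)"
      using red_eq_0 by blast
    have "is_cycle act G D e m (scale_chain h s)"
      using boundary_is_cycle[of p m] p(2) s(1) Suc by simp
    \<comment> \<open>Here h is cancelled: in the resolved module if m = 0, in a free module
      otherwise.\<close>
    then have "is_cycle act G D e m s"
      using s act_torsion_free scale_chain_h_eq_0
      by (auto simp: is_cycle_def lin_ext_scale chain.lin_ext_scale split: if_splits)
    then obtain r where r: "Poly_Mapping.keys r \<subseteq> G (Suc m)" "chain_ext D r = s"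
      using exact by blast
    have "is_cycle act G D e n (p - scale_chain h r)"
      using keys_minus_subset[of p "G n" "scale_chain h r"] keys_scale_chain[of h r] p(2) r s Suc
      by (auto simp: is_cycle_def chain.lin_ext_diff chain.lin_ext_scale)
    then show ?thesis
      using r Suc by blast
  qed
  then show ?thesis
    using p(1) by (metis red_diff red_scale_h diff_zero)
qed

text \<open>Exactness descends by lifting a cycle, filling the lift over A_h and reducing the
  filling.\<close>

lemma reduced_free_resolution: "free_resolution act0 G D0 (\<lambda>g. \<rho> (e g))"
proof
  show "\<exists>p. Poly_Mapping.keys p \<subseteq> G 0 \<and> lin_ext act0 (\<lambda>g. \<rho> (e g)) p = z" for z
  proof -
    obtain x where "\<rho> x = z"
      using \<rho>_surj by blast
    moreover obtain p where "Poly_Mapping.keys p \<subseteq> G 0" "lin_ext act e p = x"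
      using augmentation_onto by blast
    ultimately show ?thesis
      using keys_red[of p] by (intro exI[of _ "red p"]) (auto simp: augmentation_red)
  qed
  show "is_cycle act0 G D0 (\<lambda>g. \<rho> (e g)) n (D0 g)" if "g \<in> G (Suc n)" for n g
    using D_cycle[OF that] by (rule is_cycle_red)
  show "\<exists>q. Poly_Mapping.keys q \<subseteq> G (Suc n) \<and> chain_ext D0 q = p"
    if cyc: "is_cycle act0 G D0 (\<lambda>g. \<rho> (e g)) n p" for n p
  proof -
    obtain p' where "is_cycle act G D e n p'" "red p' = p"
      using cycle_lift[OF cyc] by blast
    moreover from this obtain q where "Poly_Mapping.keys q \<subseteq> G (Suc n)" "chain_ext D q = p'"
      using exact by blast
    ultimately show ?thesis
      using keys_red[of q] by (intro exI[of _ "red q"]) (auto simp: chain_ext_red)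
  qed
qed


section \<open>Cohomology and its reduction modulo the formal parameter\<close>

lemma \<pi>_cobound: "\<pi> (cobound D n u g) = cobound D0 n (\<lambda>g. \<pi> (u g)) g"
  by (simp add: cobound_def pairing_red split: nat.split)

lemma cocycle_on_red: "cocycle_on G D n f \<Longrightarrow> cocycle_on G D0 n (\<lambda>g. \<pi> (f g))"
  by (simp add: cocycle_on_def pairing_red)

lemma coboundary_on_red:
  assumes "coboundary_on G D n f"
  shows "coboundary_on G D0 n (\<lambda>g. \<pi> (f g))"
proof -
  obtain u where "\<And>g. g \<in> G n \<Longrightarrow> f g = cobound D n u g"
    using assms by (rule coboundary_onE) blast
  then show ?thesis
    by (intro coboundary_onI[where u = "\<lambda>g. \<pi> (u g)"]) (simp add: \<pi>_cobound)
qed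

lemma divide_reduced_coboundary:
  assumes "coboundary_on G D0 n (\<lambda>g. \<pi> (f g))"
  shows "\<exists>u f'. \<forall>g\<in>G n. f g = cobound D n u g + f' g * h"
proof -
  obtain v where v: "\<And>g. g \<in> G n \<Longrightarrow> \<pi> (f g) = cobound D0 n v g"
    using assms by (rule coboundary_onE) blast
  obtain u where u: "\<And>g. \<pi> (u g) = v g"
    using \<pi>_lift[of v] by blast
  have "\<exists>c. f g = cobound D n u g + c * h" if "g \<in> G n" for g
  proof -
    have "\<pi> (f g - cobound D n u g) = 0"
      using v that by (simp add: \<pi>_diff \<pi>_cobound u)
    then show ?thesis
      unfolding \<pi>_kernel by (auto simp: algebra_simps)
  qed
  then show ?thesis
    by metis
qed

text \<open>Removing the coboundary of a lifted primitive leaves a cocycle divisible by h, and h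
  cancels from its cocycle equation.\<close>

lemma divide_cocycle:
  assumes "cocycle_on G D n f" "coboundary_on G D0 n (\<lambda>g. \<pi> (f g))"
  shows "\<exists>u f'. cocycle_on G D n f' \<and> (\<forall>g\<in>G n. f g = cobound D n u g + f' g * h)"
proof -
  obtain u f' where *: "\<forall>g\<in>G n. f g = cobound D n u g + f' g * h"
    using divide_reduced_coboundary[OF assms(2)] by blast
  have "cocycle_on G D n (\<lambda>g. f g - cobound D n u g)"
    using assms(1) cocycle_on_cobound by (rule cocycle_on_diff)
  then have "cocycle_on G D n (\<lambda>g. f' g * h)"
    by (rule cocycle_on_cong) (simp add: *)
  then have "cocycle_on G D n f'"
    using torsion_free by (simp add: cocycle_on_def pairing_mult_right)
  with * show ?thesis
    by blast
qed

text \<open>Cohomology modulo h embeds into the cohomology of the reduced complex. This later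
  identifies the fibres of the reduction map with the cosets of h Ext.\<close>

lemma coboundary_on_red_iff:
  assumes "cocycle_on G D n f"
  shows "coboundary_on G D0 n (\<lambda>g. \<pi> (f g)) \<longleftrightarrow>
    (\<exists>f'. cocycle_on G D n f' \<and> coboundary_on G D n (\<lambda>g. f g - f' g * h))"
proof
  assume "coboundary_on G D0 n (\<lambda>g. \<pi> (f g))"
  then obtain u f' where "cocycle_on G D n f'" "\<forall>g\<in>G n. f g = cobound D n u g + f' g * h"
    using divide_cocycle[OF assms] by blast
  then show "\<exists>f'. cocycle_on G D n f' \<and> coboundary_on G D n (\<lambda>g. f g - f' g * h)"
    by (intro exI[of _ f'] conjI coboundary_onI[where u = u]) auto
next
  assume "\<exists>f'. cocycle_on G D n f' \<and> coboundary_on G D n (\<lambda>g. f g - f' g * h)"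
  then show "coboundary_on G D0 n (\<lambda>g. \<pi> (f g))"
    using coboundary_on_red by (fastforce simp: \<pi>_diff)
qed

text \<open>
  Successive approximation: \<open>u\<close> is corrected by a scalar multiple of \<open>f\<close> and a coboundary modulo
  \<open>h\<close>, the remainder is divided by \<open>h\<close>, and the corrections are summed by completeness.
\<close>

lemma cohomology_generated:
  assumes f: "cocycle_on G D n f" and u: "cocycle_on G D n u"
    and gen: "\<And>u. cocycle_on G D n u \<Longrightarrow>
      \<exists>c. coboundary_on G D0 n (\<lambda>g. \<pi> (u g - f g * \<kappa> (fps_const c)))"
  shows "\<exists>C. coboundary_on G D n (\<lambda>g. u g - f g * \<kappa> C)"
proof -
  have step: "\<exists>c w u'. cocycle_on G D n u' \<and>
      (\<forall>g\<in>G n. u g = f g * \<kappa> (fps_const c) + cobound D n w g + u' g * h)"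
    if "cocycle_on G D n u" for u
  proof -
    obtain c where c: "coboundary_on G D0 n (\<lambda>g. \<pi> (u g - f g * \<kappa> (fps_const c)))"
      using gen[OF \<open>cocycle_on G D n u\<close>] by blast
    have "cocycle_on G D n (\<lambda>g. u g - f g * \<kappa> (fps_const c))"
      using that cocycle_on_mult[OF f] by (rule cocycle_on_diff)
    then obtain w u' where "cocycle_on G D n u'"
        "\<forall>g\<in>G n. u g - f g * \<kappa> (fps_const c) = cobound D n w g + u' g * h"
      using divide_cocycle[OF _ c] by blast
    then show ?thesis
      by (intro exI[of _ c] exI[of _ w] exI[of _ u']) (simp add: algebra_simps)
  qed
  \<comment> \<open>Dependent choice yields a sequence with some start; the clause for m = 0 makes
    that start the given \<open>u\<close>.\<close>
  have "\<exists>U. \<forall>m. (cocycle_on G D n (U m) \<and> (m = 0 \<longrightarrow> U m = u)) \<and>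
      (\<exists>c w. \<forall>g\<in>G n. U m g = f g * \<kappa> (fps_const c) + cobound D n w g + U (Suc m) g * h)"
  proof (rule dependent_nat_choice)
    show "\<exists>x. cocycle_on G D n x \<and> (0 = 0 \<longrightarrow> x = u)"
      using u by blast
    fix x and m :: nat assume "cocycle_on G D n x \<and> (m = 0 \<longrightarrow> x = u)"
    then obtain c w u' where "cocycle_on G D n u'"
        "\<forall>g\<in>G n. x g = f g * \<kappa> (fps_const c) + cobound D n w g + u' g * h"
      using step by blast
    then show "\<exists>y. (cocycle_on G D n y \<and> (Suc m = 0 \<longrightarrow> y = u)) \<and>
        (\<exists>c w. \<forall>g\<in>G n. x g = f g * \<kappa> (fps_const c) + cobound D n w g + y g * h)"
      by blast
  qed
  then obtain U where U: "U 0 = u"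
      "\<forall>m. \<exists>c w. \<forall>g\<in>G n. U m g = f g * \<kappa> (fps_const c) + cobound D n w g + U (Suc m) g * h"
    by metis
  then obtain c w where cw: "\<And>m g. g \<in> G n \<Longrightarrow>
      U m g = f g * \<kappa> (fps_const (c m)) + cobound D n (w m) g + U (Suc m) g * h"
    by metis
  obtain S :: "(nat \<Rightarrow> 'b) \<Rightarrow> 'b" where S: "\<And>t. S t = t 0 + S (\<lambda>n. t (Suc n)) * h"
    using complete by blast
  \<comment> \<open>\<open>C m\<close> and \<open>W m\<close> are the tails of the two series from
    index m on, divided by the m-th power of h. Their recurrences suffice, so no continuity of
    \<open>\<kappa>\<close> or of the coboundary enters.\<close>
  define C where "C m = Abs_fps (\<lambda>j. c (m + j))" for m
  define W where "W m g = S (\<lambda>j. w (m + j) g)" for m g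
  have C: "C m = fps_const (c m) + C (Suc m) * fps_X" for m
    by (rule fps_ext) (simp add: C_def fps_X_mult_right_nth)
  have W: "W m = (\<lambda>g. w m g + W (Suc m) g * h)" for m
    using S[of "\<lambda>j. w (m + j) _"] by (simp add: W_def fun_eq_iff)
  have "u g - f g * \<kappa> (C 0) = cobound D n (W 0) g" if "g \<in> G n" for g
  proof -
    \<comment> \<open>The error left at stage m. Each error is h times the next, so the error at
      stage 0 vanishes by separatedness.\<close>
    define t where "t m = U m g - f g * \<kappa> (C m) - cobound D n (W m) g" for m
    have "t m = t (Suc m) * h" for m
    proof -
      have "\<kappa> (C m) = \<kappa> (fps_const (c m)) + \<kappa> (C (Suc m)) * h"
        by (subst C) (simp only: \<kappa>_add \<kappa>_mult)
      moreover have "cobound D n (W m) g = cobound D n (w m) g + cobound D n (W (Suc m)) g * h"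
        by (subst W) (simp only: cobound_add cobound_mult)
      ultimately show ?thesis
        using cw[OF that, of m] by (simp add: t_def algebra_simps)
    qed
    then have "t 0 = 0"
      by (rule separated)
    then show ?thesis
      by (simp add: t_def U(1))
  qed
  then show ?thesis
    by (intro exI[of _ "C 0"] coboundary_onI)
qed

text \<open>The case of the generating cocycle 0, where every scalar will do.\<close>

lemma cohomology_vanishes:
  assumes "\<And>f. cocycle_on G D0 n f \<Longrightarrow> coboundary_on G D0 n f" "cocycle_on G D n f"
  shows "coboundary_on G D n f"
  using cohomology_generated[OF cocycle_on_zero assms(2)] assms(1) cocycle_on_red by simp

text \<open>The obstruction is a connecting map: any lift \<open>f\<close> has coboundary
  \<open>c\<close> times h, and cancelling h shows that \<open>c\<close> is a cocycle of degree n +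
  1. A primitive \<open>u\<close> of \<open>c\<close> corrects the lift to \<open>f\<close> minus
  \<open>u\<close> times h.\<close>

lemma cocycle_lifts:
  assumes H: "\<And>f. cocycle_on G D (Suc n) f \<Longrightarrow> coboundary_on G D (Suc n) f"
    and "cocycle_on G D0 n f0"
  shows "\<exists>f. cocycle_on G D n f \<and> (\<forall>g. \<pi> (f g) = f0 g)"
proof -
  obtain f where f: "\<And>g. \<pi> (f g) = f0 g"
    using \<pi>_lift[of f0] by blast
  have "\<exists>c. pairing f (D g) = c * h" if "g \<in> G (Suc n)" for g
  proof -
    have "\<pi> (pairing f (D g)) = 0"
      using assms(2) that by (simp add: pairing_red[symmetric] f cocycle_on_def)
    then show ?thesis by (simp add: \<pi>_kernel)
  qed
  then obtain c where c: "\<And>g. g \<in> G (Suc n) \<Longrightarrow> pairing f (D g) = c g * h"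
    by metis
  have "cocycle_on G D (Suc n) (\<lambda>g. pairing f (D g))"
    using cocycle_on_cobound[of "Suc n" f] by (simp add: cobound_def[abs_def])
  then have "cocycle_on G D (Suc n) (\<lambda>g. c g * h)"
    using c by (rule cocycle_on_cong)
  then have "cocycle_on G D (Suc n) c"
    using torsion_free by (simp add: cocycle_on_def pairing_mult_right)
  then obtain u where u: "\<And>g. g \<in> G (Suc n) \<Longrightarrow> c g = pairing u (D g)"
    using H[of c] by (auto simp: coboundary_on_def cobound_def)
  have "cocycle_on G D n (\<lambda>g. f g - u g * h)"
    using c u by (simp add: cocycle_on_def pair.lin_ext_diff_fun pairing_mult_right)
  then show ?thesis
    using f by (intro exI[of _ "\<lambda>g. f g - u g * h"]) (simp add: \<pi>_diff)
qed

text \<open>If \<open>u\<close> is a primitive of \<open>f\<close> times h, it is a cocycle modulo h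
  one degree lower, hence a coboundary plus \<open>u'\<close> times h. Cancelling h makes
  \<open>u'\<close> a primitive of \<open>f\<close>. In degree 0, which has no lower degree, torsion
  freeness of A_h suffices.\<close>

lemma cohomology_torsion_free:
  assumes H: "\<And>m f. n = Suc m \<Longrightarrow> cocycle_on G D0 m f \<Longrightarrow> coboundary_on G D0 m f"
    and "coboundary_on G D n (\<lambda>g. f g * h)"
  shows "coboundary_on G D n f"
proof -
  obtain u where u: "\<And>g. g \<in> G n \<Longrightarrow> f g * h = cobound D n u g"
    using assms(2) by (rule coboundary_onE) blast
  show ?thesis
  proof (cases n)
    case 0
    then show ?thesis
      using u torsion_free by (intro coboundary_onI[where u = u]) (simp add: cobound_def)
  next
    case (Suc m)
    have "cocycle_on G D0 m (\<lambda>g. \<pi> (u g))"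
      using u Suc by (auto simp: cocycle_on_def pairing_red cobound_def) (metis \<pi>_h)
    then obtain v u' where v: "\<forall>g\<in>G m. u g = cobound D m v g + u' g * h"
      using divide_reduced_coboundary H[OF Suc] by blast
    have "f g = cobound D n u' g" if "g \<in> G n" for g
    proof -
      have "f g * h = pairing u (D g)"
        using u that Suc by (simp add: cobound_def)
      also have "\<dots> = pairing (\<lambda>g. cobound D m v g + u' g * h) (D g)"
        using v keys_D[of g m] that Suc by (intro pair.lin_ext_cong) auto
      also have "\<dots> = pairing u' (D g) * h"
        using cocycle_on_cobound[of m v] that Suc
        by (simp add: pair.lin_ext_add_fun pairing_mult_right cocycle_on_def)
      finally have "(f g - pairing u' (D g)) * h = 0"
        by (simp add: algebra_simps)
      then show ?thesis
        using torsion_free Suc by (fastforce simp: cobound_def)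
    qed
    then show ?thesis
      by (rule coboundary_onI)
  qed
qed

text \<open>A nonzero \<open>C\<close> is a unit times a power of h. Cancelling the factors h one by
  one and inverting the unit would make \<open>f\<close> a coboundary, hence also its
  reduction.\<close>

lemma cohomology_scalar_torsion_free:
  assumes H: "\<And>m f. n = Suc m \<Longrightarrow> cocycle_on G D0 m f \<Longrightarrow> coboundary_on G D0 m f"
    and f: "\<not> coboundary_on G D0 n (\<lambda>g. \<pi> (f g))"
    and C: "coboundary_on G D n (\<lambda>g. f g * \<kappa> C)"
  shows "C = 0"
proof (rule ccontr)
  assume "C \<noteq> 0"
  define U where "U = fps_shift (subdegree C) C"
  have U0: "fps_nth U 0 \<noteq> 0"
    using \<open>C \<noteq> 0\<close> by (simp add: U_def)
  have CU: "C = U * fps_X ^ subdegree C"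
    unfolding U_def by (rule subdegree_decompose)
  have "coboundary_on G D n (\<lambda>g. f g * \<kappa> (U * fps_X ^ j)) \<Longrightarrow> coboundary_on G D n (\<lambda>g. f g * \<kappa> U)" for j
  proof (induction j)
    case (Suc j)
    have "\<kappa> (U * fps_X ^ Suc j) = \<kappa> (U * fps_X ^ j) * h"
      by (simp add: \<kappa>_mult[symmetric] algebra_simps)
    then have "coboundary_on G D n (\<lambda>g. f g * \<kappa> (U * fps_X ^ j) * h)"
      using Suc.prems by (simp add: mult.assoc)
    then have "coboundary_on G D n (\<lambda>g. f g * \<kappa> (U * fps_X ^ j))"
      by (rule cohomology_torsion_free[rotated]) (rule H)
    then show ?case
      by (rule Suc.IH)
  qed simp
  then have "coboundary_on G D n (\<lambda>g. f g * \<kappa> U)"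
    using C CU by metis
  then have "coboundary_on G D n (\<lambda>g. f g * \<kappa> U * \<kappa> (inverse U))"
    by (rule coboundary_on_mult)
  moreover have "\<kappa> U * \<kappa> (inverse U) = 1"
    using U0 by (simp add: \<kappa>_mult[symmetric] mult.commute[of U] inverse_mult_eq_1 \<kappa>_one)
  ultimately have "coboundary_on G D n f"
    by (simp add: mult.assoc)
  then show False
    using f coboundary_on_red by blast
qed

end


section \<open>Deformations\<close>

lemma class_mod_h_eq: "class_mod_h scaleh x = (\<lambda>y. x + scaleh fps_X y) ` UNIV"
  by (simp add: class_mod_h_def coset_def type_module_def image_image)

lemma fps_scale_X_nth:
  assumes "vector_space scaleV"
  shows "fps_nth (fps_scale scaleV fps_X v) n = (case n of 0 \<Rightarrow> 0 | Suc m \<Rightarrow> fps_nth v m)"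
proof -
  interpret vector_space scaleV by fact
  have "scaleV (fps_nth fps_X i) w = (if i = 1 then w else 0)" for i w
    by simp
  then have "fps_nth (fps_scale scaleV fps_X v) n =
      (\<Sum>i=0..n. if i = 1 then fps_nth v (n - i) else 0)"
    unfolding fps_scale_def by (simp only: fps_nth_Abs_fps)
  then show ?thesis
    by (cases n) simp_all
qed

text \<open>Torsion freeness, separatedness and completeness are checked on the coefficients in V
  after transport to V[[h]], where multiplication by h is the shift.\<close>

lemma formal_deformation_of_deformation:
  assumes "deformation scaleV scaleh scale0 \<phi>"
  shows "formal_deformation (\<lambda>b. \<phi> (class_mod_h scaleh b)) (\<lambda>c. scaleh c 1)"
proof -
  let ?\<pi> = "\<lambda>b. \<phi> (class_mod_h scaleh b)" and ?h = "scaleh fps_X 1"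
  interpret algebra_over scaleh
    using assms by (simp add: deformation_def)
  have mult_scale: "b * scaleh c 1 = scaleh c b" and scale_mult: "scaleh c 1 * b = scaleh c b" for b c
    by (simp_all add: scale_mult_left scale_mult_right)
  have vs: "vector_space scaleV"
    using assms by (simp add: deformation_def topologically_free_def)
  have "\<exists>\<Psi>. bij \<Psi> \<and> (\<forall>x y. \<Psi> (x + y) = \<Psi> x + \<Psi> y) \<and>
      (\<forall>c x. \<Psi> (scaleh c x) = fps_scale scaleV c (\<Psi> x))"
    using assms by (simp add: deformation_def topologically_free_def module_iso_def type_module_def)
  then obtain \<Psi> where \<Psi>: "bij \<Psi>" "\<And>x y. \<Psi> (x + y) = \<Psi> x + \<Psi> y"
      "\<And>c x. \<Psi> (scaleh c x) = fps_scale scaleV c (\<Psi> x)"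
    by blast
  define coef where "coef x n = fps_nth (\<Psi> x) n" for x n
  have coef_add: "coef (x + y) n = coef x n + coef y n" for x y n
    by (simp add: coef_def \<Psi>)
  have coef_h: "coef (x * ?h) n = (case n of 0 \<Rightarrow> 0 | Suc m \<Rightarrow> coef x m)" for x n
    by (simp add: coef_def mult_scale \<Psi>(3) fps_scale_X_nth[OF vs] split: nat.split)
  have coef_eqI: "x = y" if "\<And>n. coef x n = coef y n" for x y
  proof (rule injD[OF bij_is_inj[OF \<Psi>(1)]], rule fps_ext)
    show "fps_nth (\<Psi> x) n = fps_nth (\<Psi> y) n" for n
      using that by (simp add: coef_def)
  qed
  have coef_0: "coef 0 n = 0" for n
    using coef_add[of 0 0 n] by simp
  have coef_surj: "\<exists>x. \<forall>n. coef x n = t n" for t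
    using bij_is_surj[OF \<Psi>(1)] by (metis coef_def fps_nth_Abs_fps surjD)
  have iso: "quotient_algebra_iso scaleh scale0 \<phi>"
    using assms by (simp add: deformation_def)
  have carrier: "Carrier (reduction (type_module scaleh) fps_X) = range (class_mod_h scaleh)"
    by (simp add: reduction_def quotient_module_def type_module_def class_mod_h_def coset_def)
  have \<pi>_add: "?\<pi> (x + y) = ?\<pi> x + ?\<pi> y" for x y
    using iso unfolding quotient_algebra_iso_def by blast
  have bij: "bij_betw \<phi> (range (class_mod_h scaleh)) UNIV"
    using iso unfolding quotient_algebra_iso_def carrier by blast
  show ?thesis
  proof
    show "?\<pi> (x + y) = ?\<pi> x + ?\<pi> y" for x y
      by (rule \<pi>_add)
    show "?\<pi> (x * y) = ?\<pi> x * ?\<pi> y" "?\<pi> 1 = 1" for x y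
      using iso unfolding quotient_algebra_iso_def by blast+
    show "\<exists>b. ?\<pi> b = a" for a
      using bij by (metis (no_types, lifting) UNIV_I bij_betw_imp_surj_on imageE)
    show "scaleh (x + y) 1 = scaleh x 1 + scaleh y 1" for x y
      by (rule scale_left_distrib)
    show "scaleh (x * y) 1 = scaleh x 1 * scaleh y 1" for x y
      by (simp add: scale_mult)
    show "scaleh 1 1 = 1"
      by simp
    show "scaleh x 1 * b = b * scaleh x 1" for x b
      by (simp add: scale_mult mult_scale)
    show "?\<pi> b = 0 \<longleftrightarrow> (\<exists>c. b = c * ?h)" for b
    proof -
      have "?\<pi> 0 = 0"
        using \<pi>_add[of 0 0] by simp
      then have "?\<pi> b = 0 \<longleftrightarrow> ?\<pi> b = ?\<pi> 0"
        by simp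
      \<comment> \<open>\<open>\<phi>\<close> is known to be injective only on cosets of h A_h, so
        the kernel of the reduction is read off from equality of cosets.\<close>
      also have "\<dots> \<longleftrightarrow> class_mod_h scaleh b = class_mod_h scaleh 0"
        using bij_betw_imp_inj_on[OF bij] by (auto dest: inj_onD)
      also have "\<dots> \<longleftrightarrow> (\<exists>c. b = scaleh fps_X c)"
      proof
        assume "class_mod_h scaleh b = class_mod_h scaleh 0"
        moreover have "b \<in> class_mod_h scaleh b"
          by (auto simp: class_mod_h_eq intro!: image_eqI[of _ _ 0])
        ultimately show "\<exists>c. b = scaleh fps_X c"
          by (auto simp: class_mod_h_eq)
      next
        assume "\<exists>c. b = scaleh fps_X c"
        then obtain c where c: "b = scaleh fps_X c" by blast
        have "0 + scaleh fps_X z = b + scaleh fps_X (z - c)" for z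
          by (simp add: c scale_right_diff_distrib)
        moreover have "b + scaleh fps_X z = 0 + scaleh fps_X (c + z)" for z
          by (simp add: c scale_right_distrib)
        ultimately show "class_mod_h scaleh b = class_mod_h scaleh 0"
          unfolding class_mod_h_eq by blast
      qed
      finally show ?thesis
        by (simp add: mult_scale)
    qed
    show "b = 0" if "b * ?h = 0" for b
    proof (rule coef_eqI)
      fix n
      show "coef b n = coef 0 n"
        using coef_h[of b "Suc n"] by (simp add: that coef_0)
    qed
    show "t 0 = 0" if "\<And>n. t n = t (Suc n) * ?h" for t
    proof (rule coef_eqI)
      \<comment> \<open>The index n is kept general because coefficient m + 1 of \<open>t n\<close>
        is coefficient m of \<open>t (Suc n)\<close>.\<close>
      have "coef (t n) m = 0" for n m
      proof (induction m arbitrary: n)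
        case 0
        show ?case
          by (subst that) (simp add: coef_h)
      next
        case (Suc m)
        show ?case
          by (subst that) (simp add: coef_h Suc)
      qed
      then show "coef (t 0) m = coef 0 m" for m
        by (simp add: coef_0)
    qed
    show "\<exists>S. \<forall>t. S t = t 0 + S (\<lambda>n. t (Suc n)) * ?h"
    proof -
      \<comment> \<open>The coefficients of the sum of all \<open>t n\<close> times the n-th power
        of h; only the terms with n at most m reach coefficient m.\<close>
      have "\<forall>t. \<exists>x. \<forall>m. coef x m = (\<Sum>n\<le>m. coef (t n) (m - n))"
        by (intro allI coef_surj)
      then obtain S where S: "\<And>t m. coef (S t) m = (\<Sum>n\<le>m. coef (t n) (m - n))"
        by metis
      have "coef (S t) m = coef (t 0 + S (\<lambda>n. t (Suc n)) * ?h) m" for t m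
        by (cases m) (simp_all add: S coef_add coef_h sum.atMost_Suc_shift del: sum.atMost_Suc)
      then show ?thesis
        using coef_eqI by blast
    qed
  qed
qed

text \<open>\<open>f\<close> represents the preimage of 1 under the isomorphism with k. The scalar
  attached to another cocycle is the image of its class.\<close>

lemma Ext_generator:
  assumes "algebra_over scale0" "left_module act0"
    and "scalar_module scale0 (Ext d act0) \<cong>\<^sub>m regular_module"
  obtains f where "cocycle_on (gens act0) gen_boundary d f"
    "\<not> coboundary_on (gens act0) gen_boundary d f"
    "\<And>z. cocycle_on (gens act0) gen_boundary d z \<Longrightarrow>
       \<exists>c. coboundary_on (gens act0) gen_boundary d (\<lambda>g. z g - f g * scale0 c 1)"
proof -
  interpret left_module act0 by fact
  interpret algebra_over scale0 by fact
  let ?E = "Ext d act0" and ?cl = "ext_class d act0"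
  obtain F where F: "bij_betw F (Carrier ?E) UNIV"
      "\<And>x y. x \<in> Carrier ?E \<Longrightarrow> y \<in> Carrier ?E \<Longrightarrow> F (Add ?E x y) = F x + F y"
      "\<And>a x. x \<in> Carrier ?E \<Longrightarrow> F (Act ?E (scale0 a 1) x) = a * F x"
    using assms(3) unfolding module_iso_def by (auto simp: restrict_scalars_def type_module_def)
  note inj = inj_onD[OF bij_betw_imp_inj_on[OF F(1)]]
  have "1 \<in> F ` Carrier ?E"
    using F(1) by (simp add: bij_betw_def)
  then obtain f where f: "F (?cl f) = 1" "cocycle_on (gens act0) gen_boundary d f"
    by (force simp: Carrier_Ext)
  have carrier: "?cl z \<in> Carrier ?E" if "cocycle_on (gens act0) gen_boundary d z" for z
    using that by (auto simp: Carrier_Ext)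
  have "F (?cl (\<lambda>_. 0)) = 0"
    using F(2)[OF carrier carrier, OF cocycle_on_zero cocycle_on_zero] by (simp add: Add_Ext)
  then have "?cl f \<noteq> ?cl (\<lambda>_. 0)"
    using f(1) by auto
  then have "\<not> coboundary_on (gens act0) gen_boundary d f"
    by (simp add: ext_class_eq_iff)
  moreover have "\<exists>c. coboundary_on (gens act0) gen_boundary d (\<lambda>g. z g - f g * scale0 c 1)"
    if z: "cocycle_on (gens act0) gen_boundary d z" for z
  proof -
    let ?c = "F (?cl z)"
    have "F (?cl z) = F (?cl (\<lambda>g. f g * scale0 ?c 1))"
      using F(3)[OF carrier[OF f(2)], of ?c] by (simp add: Act_Ext f(1))
    then have "?cl z = ?cl (\<lambda>g. f g * scale0 ?c 1)"
      by (rule inj[OF _ carrier carrier]) (simp_all add: z cocycle_on_mult f(2))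
    then show ?thesis
      by (auto simp: ext_class_eq_iff)
  qed
  ultimately show thesis
    using that f(2) by blast
qed

theorem theorem5p0p7:
  fixes scaleV :: "'k::field_char_0 \<Rightarrow> 'v::ab_group_add \<Rightarrow> 'v"
    and scale0 :: "'k \<Rightarrow> 'a::ring_1 \<Rightarrow> 'a"
    and scaleh :: "'k fps \<Rightarrow> 'b::ring_1 \<Rightarrow> 'b"
    and \<phi> :: "'b set \<Rightarrow> 'a"
    and act0 :: "'a \<Rightarrow> 'k \<Rightarrow> 'k"
    and acth :: "'b \<Rightarrow> 'k fps \<Rightarrow> 'k fps"
    and d :: nat
  assumes "algebra_over scale0"
    and "noetherian TYPE('a)"
    and "deformation scaleV scaleh scale0 \<phi>"
    and "module_on_scalars scale0 act0"
    and "\<forall>i. i \<noteq> d \<longrightarrow> zero_module (Ext i act0)"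
    and "scalar_module scale0 (Ext d act0) \<cong>\<^sub>m regular_module"
    and "module_on_scalars scaleh acth"
    and "reduces_to scaleh \<phi> acth act0"
  shows "(\<forall>i. i \<noteq> d \<longrightarrow> zero_module (Ext i acth)) \<and>
    free_of_rank_1 (scalar_module scaleh (Ext d acth)) \<and>
    right_module (Ext d acth) \<and>
    is_lift scaleh \<phi> (Ext d acth) (Ext d act0)"
proof -

  \<comment> \<open>The reduced resolution of K and its comparison with the standard resolution of
    k\<close>
  define \<pi> where "\<pi> b = \<phi> (class_mod_h scaleh b)" for b
  define \<kappa> where "\<kappa> c = scaleh c 1" for c
  interpret M0: module_on_scalars scale0 act0 by fact
  interpret Mh: module_on_scalars scaleh acth by fact
  interpret F: formal_deformation \<pi> \<kappa>
    using formal_deformation_of_deformation[OF assms(3)] by (simp add: \<pi>_def[abs_def] \<kappa>_def[abs_def])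
  interpret free_resolution acth "gens acth" gen_boundary gen_augmentation
    by (rule standard_free_resolution) (rule Mh.left_module_axioms)
  have act_\<kappa>: "acth (\<kappa> c) x = c * x" for c x
    by (simp add: \<kappa>_def Mh.act_scale_left Mh.act_one)
  interpret deformed_resolution \<pi> \<kappa> acth "gens acth" gen_boundary gen_augmentation act0
    "\<lambda>x. fps_nth x 0"
  proof
    show "fps_nth (acth b x) 0 = act0 (\<pi> b) (fps_nth x 0)" for b x
      using assms(8) by (simp add: reduces_to_def \<pi>_def)
    show "\<exists>x. fps_nth x 0 = z" for z :: 'k
      by (intro exI[of _ "fps_const z"]) simp
    \<comment> \<open>On K the element h acts by multiplication, and \<open>fps_shift 1\<close>
      divides by it when the constant term is 0.\<close>
    show "\<exists>y. x = acth (\<kappa> fps_X) y" if "fps_nth x 0 = 0" for x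
      by (intro exI[of _ "fps_shift 1 x"] fps_ext) (use that in \<open>simp add: act_\<kappa>\<close>)
    show "x = 0" if "acth (\<kappa> fps_X) x = 0" for x
      using that by (simp add: act_\<kappa>)
  qed simp
  interpret R0: free_resolution act0 "gens act0" gen_boundary gen_augmentation
    by (rule standard_free_resolution) (rule M0.left_module_axioms)
  interpret R: free_resolution act0 "gens acth" D0 "\<lambda>g. fps_nth (gen_augmentation g) 0"
    by (rule reduced_free_resolution)
  interpret T: two_resolutions act0 "gens act0" gen_boundary gen_augmentation
    "gens acth" D0 "\<lambda>g. fps_nth (gen_augmentation g) 0" ..
  obtain \<psi> where \<psi>: "chain_map act0 (gens act0) gen_boundary gen_augmentation
      (gens acth) D0 (\<lambda>g. fps_nth (gen_augmentation g) 0) \<psi>"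
    using T.chain_map_exists by blast
  \<comment> \<open>Restriction along \<open>\<psi>\<close> carries degree d cochains of the reduced
    resolution to cochains of the standard resolution of k.\<close>
  define pull where "pull z = (\<lambda>g. pairing z (\<psi> d g))" for z
  have pull_add: "pull (\<lambda>g. y g + z g) = (\<lambda>g. pull y g + pull z g)"
    and pull_diff: "pull (\<lambda>g. y g - z g) = (\<lambda>g. pull y g - pull z g)"
    and pull_mult: "pull (\<lambda>g. y g * a) = (\<lambda>g. pull y g * a)" for y z a
    by (simp_all add: pull_def pair.lin_ext_add_fun pair.lin_ext_diff_fun pairing_mult_right)
  have pull_cocycle: "cocycle_on (gens act0) gen_boundary d (pull z)"
    if "cocycle_on (gens acth) D0 d z" for z
    using T.cocycle_pullback[OF \<psi> that] by (simp add: pull_def)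
  have pull_coboundary: "coboundary_on (gens act0) gen_boundary d (pull z) \<longleftrightarrow>
      coboundary_on (gens acth) D0 d z" if "cocycle_on (gens acth) D0 d z" for z
    using T.coboundary_pullback_iff[OF \<psi> that] by (simp add: pull_def)

  \<comment> \<open>Vanishing outside degree d, and lifting of cocycles in degree d\<close>
  have zero0: "coboundary_on (gens acth) D0 i z"
    if "i \<noteq> d" "cocycle_on (gens acth) D0 i z" for i z
    using T.coboundary_pullback_iff[OF \<psi> that(2)] T.cocycle_pullback[OF \<psi> that(2)] that(1) assms(5)
    by (simp add: M0.zero_module_Ext_iff)
  have zero: "coboundary_on (gens acth) gen_boundary i f"
    if "i \<noteq> d" "cocycle_on (gens acth) gen_boundary i f" for i f
    using cohomology_vanishes[OF zero0[OF that(1)] that(2)] .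
  \<comment> \<open>The obstruction lies in degree d + 1, where the cohomology over A_h already
    vanishes.\<close>
  have lift: "\<exists>f. cocycle_on (gens acth) gen_boundary d f \<and> (\<forall>g. \<pi> (f g) = z g)"
    if "cocycle_on (gens acth) D0 d z" for z
    using cocycle_lifts[OF zero that] by simp

  \<comment> \<open>A cocycle over A_h that generates the cohomology in degree d\<close>
  obtain f0 where f0: "cocycle_on (gens act0) gen_boundary d f0"
      "\<not> coboundary_on (gens act0) gen_boundary d f0"
      "\<And>z. cocycle_on (gens act0) gen_boundary d z \<Longrightarrow>
         \<exists>c. coboundary_on (gens act0) gen_boundary d (\<lambda>g. z g - f0 g * scale0 c 1)"
    using Ext_generator[OF assms(1) M0.left_module_axioms assms(6)] by blast
  have onto: "\<exists>f. cocycle_on (gens acth) gen_boundary d f \<and>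
      coboundary_on (gens act0) gen_boundary d (\<lambda>g. pull (\<lambda>g. \<pi> (f g)) g - y g)"
    if y: "cocycle_on (gens act0) gen_boundary d y" for y
  proof -
    obtain z where z: "cocycle_on (gens acth) D0 d z"
        "coboundary_on (gens act0) gen_boundary d (\<lambda>g. pull z g - y g)"
      using T.cocycle_pullback_onto[OF \<psi> y] by (auto simp: pull_def)
    obtain f where "cocycle_on (gens acth) gen_boundary d f" "\<And>g. \<pi> (f g) = z g"
      using lift[OF z(1)] by blast
    then show ?thesis
      using z(2) by auto
  qed
  obtain f where f: "cocycle_on (gens acth) gen_boundary d f"
      and f_f0: "coboundary_on (gens act0) gen_boundary d (\<lambda>g. pull (\<lambda>g. \<pi> (f g)) g - f0 g)"
    using onto[OF f0(1)] by blast
  have f_nontrivial: "\<not> coboundary_on (gens acth) D0 d (\<lambda>g. \<pi> (f g))"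
  proof
    assume "coboundary_on (gens acth) D0 d (\<lambda>g. \<pi> (f g))"
    then have "coboundary_on (gens act0) gen_boundary d (pull (\<lambda>g. \<pi> (f g)))"
      by (simp add: pull_coboundary cocycle_on_red f)
    from coboundary_on_diff[OF this f_f0] f0(2) show False
      by simp
  qed
  have \<pi>_const: "\<pi> (\<kappa> (fps_const c)) = scale0 c 1" for c
    using assms(3) by (simp add: deformation_def quotient_algebra_iso_def \<pi>_def \<kappa>_def)
  have generated: "\<exists>c. coboundary_on (gens acth) gen_boundary d (\<lambda>g. u g - f g * \<kappa> c)"
    if "cocycle_on (gens acth) gen_boundary d u" for u
  proof (rule cohomology_generated[OF f that])
    fix u assume u: "cocycle_on (gens acth) gen_boundary d u"
    obtain c where c: "coboundary_on (gens act0) gen_boundary d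
        (\<lambda>g. pull (\<lambda>g. \<pi> (u g)) g - f0 g * scale0 c 1)"
      using f0(3)[OF pull_cocycle[OF cocycle_on_red[OF u]]] by blast
    let ?z = "\<lambda>g. \<pi> (u g - f g * \<kappa> (fps_const c))"
    \<comment> \<open>The reduction of \<open>f\<close> pulls back to \<open>f0\<close> only up to a
      coboundary; the second summand accounts for the difference.\<close>
    have "pull ?z = (\<lambda>g. (pull (\<lambda>g. \<pi> (u g)) g - f0 g * scale0 c 1) -
        (pull (\<lambda>g. \<pi> (f g)) g - f0 g) * scale0 c 1)"
      by (simp add: F.\<pi>_diff F.\<pi>_mult \<pi>_const pull_diff pull_mult algebra_simps)
    then have "coboundary_on (gens act0) gen_boundary d (pull ?z)"
      using coboundary_on_diff[OF c coboundary_on_mult[OF f_f0]] by simp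
    then show "\<exists>c. coboundary_on (gens acth) D0 d (\<lambda>g. \<pi> (u g - f g * \<kappa> (fps_const c)))"
      using cocycle_on_red[OF cocycle_on_diff[OF u cocycle_on_mult[OF f]]]
      by (auto simp: pull_coboundary)
  qed
  have torsion: "c = 0" if "coboundary_on (gens acth) gen_boundary d (\<lambda>g. f g * \<kappa> c)" for c
    using zero0 f_nontrivial that by (intro cohomology_scalar_torsion_free) auto

  \<comment> \<open>Freeness of rank one over K\<close>
  let ?E = "Ext d acth" and ?cl = "ext_class d acth" and ?class = "ext_class d act0"
  let ?K = "restrict_scalars \<kappa> ?E"
  \<comment> \<open>The inverse of the required isomorphism, multiplying the generator by scalars:
    \<open>torsion\<close> makes it injective and \<open>generated\<close> makes it onto.\<close>
  define \<epsilon> where "\<epsilon> c = ?cl (\<lambda>g. f g * \<kappa> c)" for c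
  have \<epsilon>_inj: "inj \<epsilon>"
  proof (rule injI)
    fix c c' assume "\<epsilon> c = \<epsilon> c'"
    moreover have "\<kappa> (c - c') = \<kappa> c - \<kappa> c'"
      using F.\<kappa>_add[of "c - c'" c'] by simp
    ultimately have "coboundary_on (gens acth) gen_boundary d (\<lambda>g. f g * \<kappa> (c - c'))"
      by (simp add: \<epsilon>_def Mh.ext_class_eq_iff right_diff_distrib)
    then show "c = c'"
      using torsion by fastforce
  qed
  have \<epsilon>_range: "range \<epsilon> = Carrier ?E"
  proof
    show "range \<epsilon> \<subseteq> Carrier ?E"
      using cocycle_on_mult[OF f] by (auto simp: \<epsilon>_def Mh.Carrier_Ext)
    show "Carrier ?E \<subseteq> range \<epsilon>"
    proof
      fix X assume "X \<in> Carrier ?E"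
      then obtain u where u: "X = ?cl u" "cocycle_on (gens acth) gen_boundary d u"
        by (auto simp: Mh.Carrier_Ext)
      obtain c where "coboundary_on (gens acth) gen_boundary d (\<lambda>g. u g - f g * \<kappa> c)"
        using generated[OF u(2)] by blast
      then have "X = \<epsilon> c"
        by (simp add: u(1) \<epsilon>_def Mh.ext_class_eq_iff)
      then show "X \<in> range \<epsilon>" by simp
    qed
  qed
  have \<epsilon>_add: "Add ?E (\<epsilon> a) (\<epsilon> b) = \<epsilon> (a + b)" for a b
    by (simp add: \<epsilon>_def Mh.Add_Ext F.\<kappa>_add distrib_left)
  have \<epsilon>_act: "Act ?E (\<kappa> a) (\<epsilon> b) = \<epsilon> (a * b)" for a b
    by (simp add: \<epsilon>_def Mh.Act_Ext mult.assoc F.\<kappa>_mult[symmetric] mult.commute[of a b])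
  have "?K \<cong>\<^sub>m regular_module"
    unfolding module_iso_def
  proof (intro exI[of _ "inv \<epsilon>"] conjI)
    show "bij_betw (inv \<epsilon>) (Carrier ?K) (Carrier regular_module)"
      using inj_imp_bij_betw_inv[OF \<epsilon>_inj]
      by (simp add: restrict_scalars_def type_module_def \<epsilon>_range[symmetric])
  qed (auto simp: restrict_scalars_def type_module_def \<epsilon>_range[symmetric] \<epsilon>_add \<epsilon>_act
      inv_f_f[OF \<epsilon>_inj])
  moreover have "right_module ?K"
    by (rule right_module_restrict_scalars[OF Mh.right_module_Ext F.\<kappa>_add F.\<kappa>_mult F.\<kappa>_one])
  ultimately have free: "free_of_rank_1 ?K"
    by (simp add: free_of_rank_1_def)

  \<comment> \<open>Reduction of the right module modulo h\<close>
  \<comment> \<open>A class is reduced through a chosen representing cocycle;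
    \<open>\<Theta>_class\<close> removes the dependence on the choice, as coboundaries reduce to
    coboundaries.\<close>
  define \<Theta> where "\<Theta> X = ?class (pull (\<lambda>g. \<pi> ((SOME u. cocycle_on (gens acth) gen_boundary d u \<and> X = ?cl u) g)))"
    for X
  have \<Theta>_class: "\<Theta> (?cl u) = ?class (pull (\<lambda>g. \<pi> (u g)))"
    if u: "cocycle_on (gens acth) gen_boundary d u" for u
  proof -
    define v where "v = (SOME v. cocycle_on (gens acth) gen_boundary d v \<and> ?cl u = ?cl v)"
    have v: "cocycle_on (gens acth) gen_boundary d v \<and> ?cl u = ?cl v"
      unfolding v_def by (rule someI[of _ u]) (simp add: u)
    then have "coboundary_on (gens acth) D0 d (\<lambda>g. \<pi> (v g - u g))"
      by (intro coboundary_on_red) (simp add: Mh.ext_class_eq_iff[symmetric])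
    then have "coboundary_on (gens act0) gen_boundary d (pull (\<lambda>g. \<pi> (v g - u g)))"
      using v u by (simp add: pull_coboundary cocycle_on_red cocycle_on_diff)
    then show ?thesis
      by (simp add: \<Theta>_def v_def[symmetric] M0.ext_class_eq_iff F.\<pi>_diff pull_diff)
  qed
  \<comment> \<open>The kernel of \<open>\<Theta>\<close> is h Ext, written as a statement about
    fibres, the form in which the isomorphism criterion needs it.\<close>
  have \<Theta>_eq: "\<Theta> (?cl u) = \<Theta> (?cl v) \<longleftrightarrow>
      (\<exists>w. cocycle_on (gens acth) gen_boundary d w \<and> ?cl u = ?cl (\<lambda>g. v g + w g * \<kappa> fps_X))"
    if "cocycle_on (gens acth) gen_boundary d u" "cocycle_on (gens acth) gen_boundary d v" for u v
  proof -
    have uv: "cocycle_on (gens acth) gen_boundary d (\<lambda>g. u g - v g)"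
      using that by (rule cocycle_on_diff)
    have "\<Theta> (?cl u) = \<Theta> (?cl v) \<longleftrightarrow>
        coboundary_on (gens act0) gen_boundary d (pull (\<lambda>g. \<pi> (u g - v g)))"
      using that by (simp add: \<Theta>_class M0.ext_class_eq_iff F.\<pi>_diff pull_diff)
    then show ?thesis
      using coboundary_on_red_iff[OF uv] pull_coboundary[OF cocycle_on_red[OF uv]]
      by (simp add: Mh.ext_class_eq_iff algebra_simps)
  qed
  have "reduction ?E (\<kappa> fps_X) \<cong>\<^sub>m restrict_scalars \<pi> (Ext d act0)"
    unfolding reduction_def
  proof (rule quotient_module_iso[where \<Theta> = \<Theta>])
    show "\<Theta> ` Carrier ?E = Carrier (restrict_scalars \<pi> (Ext d act0))"
    proof
      show "\<Theta> ` Carrier ?E \<subseteq> Carrier (restrict_scalars \<pi> (Ext d act0))"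
        using pull_cocycle cocycle_on_red
        by (auto simp: Mh.Carrier_Ext M0.Carrier_Ext restrict_scalars_def \<Theta>_class)
      show "Carrier (restrict_scalars \<pi> (Ext d act0)) \<subseteq> \<Theta> ` Carrier ?E"
      proof
        fix Y assume "Y \<in> Carrier (restrict_scalars \<pi> (Ext d act0))"
        then obtain y where y: "Y = ?class y" "cocycle_on (gens act0) gen_boundary d y"
          by (auto simp: M0.Carrier_Ext restrict_scalars_def)
        obtain u where "cocycle_on (gens acth) gen_boundary d u"
            "coboundary_on (gens act0) gen_boundary d (\<lambda>g. pull (\<lambda>g. \<pi> (u g)) g - y g)"
          using onto[OF y(2)] by blast
        then have "Y = \<Theta> (?cl u)" "?cl u \<in> Carrier ?E"
          by (auto simp: y(1) \<Theta>_class M0.ext_class_eq_iff Mh.Carrier_Ext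
              intro: coboundary_on_diff_commute)
        then show "Y \<in> \<Theta> ` Carrier ?E" by blast
      qed
    qed
  next
    fix X assume "X \<in> Carrier ?E"
    then obtain v where v: "X = ?cl v" "cocycle_on (gens acth) gen_boundary d v"
      by (auto simp: Mh.Carrier_Ext)
    have "coset ?E (Act ?E (\<kappa> fps_X) ` Carrier ?E) X =
        {?cl (\<lambda>g. v g + w g * \<kappa> fps_X) |w. cocycle_on (gens acth) gen_boundary d w}"
      by (simp add: coset_def Mh.Carrier_Ext v(1) setcompr_eq_image image_image Mh.Act_Ext Mh.Add_Ext)
    also have "\<dots> = {Y \<in> Carrier ?E. \<Theta> Y = \<Theta> X}"
    proof (intro equalityI subsetI)
      fix Y assume "Y \<in> {?cl (\<lambda>g. v g + w g * \<kappa> fps_X) |w. cocycle_on (gens acth) gen_boundary d w}"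
      then obtain w where w: "Y = ?cl (\<lambda>g. v g + w g * \<kappa> fps_X)" "cocycle_on (gens acth) gen_boundary d w"
        by blast
      have vw: "cocycle_on (gens acth) gen_boundary d (\<lambda>g. v g + w g * \<kappa> fps_X)"
        by (intro cocycle_on_add cocycle_on_mult v w)
      then have "\<Theta> Y = \<Theta> X"
        unfolding w(1) v(1) using \<Theta>_eq[OF vw v(2)] w(2) by blast
      then show "Y \<in> {Y \<in> Carrier ?E. \<Theta> Y = \<Theta> X}"
        using vw by (auto simp: w(1) Mh.Carrier_Ext)
    next
      fix Y assume "Y \<in> {Y \<in> Carrier ?E. \<Theta> Y = \<Theta> X}"
      then obtain u where "Y = ?cl u" "cocycle_on (gens acth) gen_boundary d u" "\<Theta> Y = \<Theta> X"
        by (auto simp: Mh.Carrier_Ext)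
      then show "Y \<in> {?cl (\<lambda>g. v g + w g * \<kappa> fps_X) |w. cocycle_on (gens acth) gen_boundary d w}"
        using \<Theta>_eq[OF _ v(2), of u] by (auto simp: v(1))
    qed
    finally show "coset ?E (Act ?E (\<kappa> fps_X) ` Carrier ?E) X = {Y \<in> Carrier ?E. \<Theta> Y = \<Theta> X}" .
  next
    fix X Y assume "X \<in> Carrier ?E" "Y \<in> Carrier ?E"
    then show "\<Theta> (Add ?E X Y) = Add (restrict_scalars \<pi> (Ext d act0)) (\<Theta> X) (\<Theta> Y)"
      by (auto simp: Mh.Carrier_Ext Mh.Add_Ext M0.Add_Ext \<Theta>_class cocycle_on_add F.\<pi>_add pull_add
          restrict_scalars_def)
  next
    fix a X assume "X \<in> Carrier ?E"
    then obtain v where v: "X = ?cl v" "cocycle_on (gens acth) gen_boundary d v"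
      by (auto simp: Mh.Carrier_Ext)
    have va: "cocycle_on (gens acth) gen_boundary d (\<lambda>g. v g * a)"
      using v(2) by (rule cocycle_on_mult)
    show "Act ?E a X \<in> Carrier ?E \<and> \<Theta> (Act ?E a X) = Act (restrict_scalars \<pi> (Ext d act0)) a (\<Theta> X)"
      using va by (auto simp: v Mh.Act_Ext Mh.Carrier_Ext M0.Act_Ext \<Theta>_class F.\<pi>_mult pull_mult
          restrict_scalars_def)
  qed
  then have "is_lift scaleh \<phi> ?E (Ext d act0)"
    by (simp add: is_lift_def \<pi>_def[abs_def] \<kappa>_def)
  then show ?thesis
    using zero free Mh.right_module_Ext by (simp add: Mh.zero_module_Ext_iff \<kappa>_def[abs_def])
qed

end
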